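(* Let $G=\mathbb{C}^k\times G_1\times\cdots\times G_r$ where each $G_i$ is a connected, simply-connected simple complex Lie group. Then any left-invariant BTP Hermitian metric on $G$ preserves the product structure (i.e. it is the orthogonal product of left-invariant Hermitian metrics on the factors $\mathbb{C}^k,G_1,\dots,G_r$), is K\"ahler flat on the Euclidean factor $\mathbb{C}^k$, and on each simple factor two such metrics differ by a constant multiple of a $B$-isometry; that is, if $g$ and $h$ are two left-invariant BTP Hermitian metrics on a simple factor $G_i$ with Lie algebra $\mathfrak{g}_i$, then there exist a constant $c$ and a $B$-isometry $f$ of $\mathfrak{g}_i$ such that $h(X,Y)=c\,g(f(X),Y)$ for all $X,Y\in\mathfrak{g}_i$.
   Context: For a simple complex Lie algebra $\mathfrak{g}$ with (complex) Cartan-Killing form $B$, a $B$-isometry is a complex linear isomorphism $f\in GL(\mathfrak{g})$ with $B(f(X),f(Y))=B(X,Y)$ for all $X,Y\in\mathfrak{g}$. A left-invariant Hermitian metric on a complex Lie group (Hermitian with respect to the complex structure of the group) is viewed as a Hermitian inner product on its complex Lie algebra. For a Hermitian manifold $(M,g,J)$ the Bismut connection $\nabla^b$ is the unique linear connection with $\nabla^bg=0$, $\nabla^bJ=0$ whose torsion $T^b$ is totally skew-symmetric, i.e. $(X,Y,Z)\mapsto g(T^b(X,Y),Z)$ is a $3$-form. The metric $g$ is BTP (Bismut torsion parallel) if $\nabla^bT^b=0$. *)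

theory Defs
  imports Complex_Main "HOL-Library.Function_Algebras" "HOL-Library.Product_Plus"
begin

section \<open>Complex vector spaces\<close>

class complex_vector = ab_group_add +
  fixes scaleC :: "complex \<Rightarrow> 'a \<Rightarrow> 'a"  (infixr \<open>*\<^sub>C\<close> 75)
  assumes scaleC_add_right: "a *\<^sub>C (x + y) = a *\<^sub>C x + a *\<^sub>C y"
    and scaleC_add_left: "(a + b) *\<^sub>C x = a *\<^sub>C x + b *\<^sub>C x"
    and scaleC_scaleC: "a *\<^sub>C b *\<^sub>C x = (a * b) *\<^sub>C x"
    and scaleC_one: "1 *\<^sub>C x = x"

global_interpretation complex_vector: vector_space "scaleC :: complex \<Rightarrow> 'a \<Rightarrow> 'a::complex_vector"
  defines cdependent = complex_vector.dependent
    and crepresentation = complex_vector.representation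
    and csubspace = complex_vector.subspace
    and cspan = complex_vector.span
  by unfold_locales (auto simp: scaleC_add_right scaleC_add_left scaleC_scaleC scaleC_one)

instantiation complex :: complex_vector
begin
definition "a *\<^sub>C x = a * (x::complex)"
instance by standard (simp_all add: scaleC_complex_def algebra_simps)
end

instantiation "fun" :: (type, complex_vector) complex_vector
begin
definition "a *\<^sub>C f = (\<lambda>i. a *\<^sub>C f i)"
instance by standard
    (simp_all add: scaleC_fun_def fun_eq_iff scaleC_add_right scaleC_add_left scaleC_scaleC scaleC_one)
end

instantiation prod :: (complex_vector, complex_vector) complex_vector
begin
definition "a *\<^sub>C p = (a *\<^sub>C fst p, a *\<^sub>C snd p)"
instance by standard
    (simp_all add: scaleC_prod_def prod_eq_iff scaleC_add_right scaleC_add_left scaleC_scaleC scaleC_one)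
end


section \<open>Complex Lie algebras\<close>

text \<open>
  A Lie algebra lives on a subspace of an ambient complex vector space, so that a family of Lie
  algebras of different dimensions can be indexed by a natural number. All maps below are
  constrained on the carrier only.
\<close>

record 'a lie =
  lie_carrier :: "'a set"
  lie_bracket :: "'a \<Rightarrow> 'a \<Rightarrow> 'a"

locale complex_lie_algebra =
  fixes L :: "'a::complex_vector lie"
  assumes subspace_carrier: "csubspace (lie_carrier L)"
    and finite_dim: "\<exists>b. finite b \<and> cspan b = lie_carrier L"
    and bracket_closed: "\<lbrakk>x \<in> lie_carrier L; y \<in> lie_carrier L\<rbrakk> \<Longrightarrow> lie_bracket L x y \<in> lie_carrier L"
    and bracket_add_left:
      "\<lbrakk>x \<in> lie_carrier L; y \<in> lie_carrier L; z \<in> lie_carrier L\<rbrakk>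
        \<Longrightarrow> lie_bracket L (x + y) z = lie_bracket L x z + lie_bracket L y z"
    and bracket_add_right:
      "\<lbrakk>x \<in> lie_carrier L; y \<in> lie_carrier L; z \<in> lie_carrier L\<rbrakk>
        \<Longrightarrow> lie_bracket L x (y + z) = lie_bracket L x y + lie_bracket L x z"
    and bracket_scale_left:
      "\<lbrakk>x \<in> lie_carrier L; y \<in> lie_carrier L\<rbrakk> \<Longrightarrow> lie_bracket L (a *\<^sub>C x) y = a *\<^sub>C lie_bracket L x y"
    and bracket_scale_right:
      "\<lbrakk>x \<in> lie_carrier L; y \<in> lie_carrier L\<rbrakk> \<Longrightarrow> lie_bracket L x (a *\<^sub>C y) = a *\<^sub>C lie_bracket L x y"
    and bracket_self: "x \<in> lie_carrier L \<Longrightarrow> lie_bracket L x x = 0"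
    and jacobi:
      "\<lbrakk>x \<in> lie_carrier L; y \<in> lie_carrier L; z \<in> lie_carrier L\<rbrakk>
        \<Longrightarrow> lie_bracket L x (lie_bracket L y z) + lie_bracket L y (lie_bracket L z x)
            + lie_bracket L z (lie_bracket L x y) = 0"

definition lie_ideal :: "'a::complex_vector lie \<Rightarrow> 'a set \<Rightarrow> bool" where
  "lie_ideal L I \<longleftrightarrow> csubspace I \<and> I \<subseteq> lie_carrier L \<and>
     (\<forall>x\<in>lie_carrier L. \<forall>y\<in>I. lie_bracket L x y \<in> I)"

definition simple_complex_lie_algebra :: "'a::complex_vector lie \<Rightarrow> bool" where
  "simple_complex_lie_algebra L \<longleftrightarrow> complex_lie_algebra L \<and>
     (\<exists>x\<in>lie_carrier L. \<exists>y\<in>lie_carrier L. lie_bracket L x y \<noteq> 0) \<and>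
     (\<forall>I. lie_ideal L I \<longrightarrow> I = {0} \<or> I = lie_carrier L)"

text \<open>The abelian Lie algebra of the group \<open>\<complex>\<^sup>k\<close>; vectors are sequences vanishing from index \<open>k\<close> on.\<close>

definition euclidean_lie :: "nat \<Rightarrow> (nat \<Rightarrow> complex) lie" where
  "euclidean_lie k = \<lparr>lie_carrier = {x. \<forall>j\<ge>k. x j = 0}, lie_bracket = (\<lambda>x y. 0)\<rparr>"

text \<open>The Lie algebra of \<open>\<complex>\<^sup>k \<times> G\<^sub>1 \<times> \<dots> \<times> G\<^sub>r\<close>, where \<open>G\<^sub>1, \<dots>, G\<^sub>r\<close> have
  Lie algebras \<open>L 0, \<dots>, L (r - 1)\<close>.\<close>

definition product_lie ::
  "nat \<Rightarrow> nat \<Rightarrow> (nat \<Rightarrow> 'a::complex_vector lie) \<Rightarrow> ((nat \<Rightarrow> complex) \<times> (nat \<Rightarrow> 'a)) lie" where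
  "product_lie k r L =
     \<lparr>lie_carrier = {(x, u). x \<in> lie_carrier (euclidean_lie k) \<and>
                             (\<forall>i<r. u i \<in> lie_carrier (L i)) \<and> (\<forall>i\<ge>r. u i = 0)},
      lie_bracket = (\<lambda>(x, u) (y, v). (lie_bracket (euclidean_lie k) x y,
                       \<lambda>i. if i < r then lie_bracket (L i) (u i) (v i) else 0))\<rparr>"


section \<open>Cartan-Killing form and its isometries\<close>

definition lie_trace :: "'a::complex_vector lie \<Rightarrow> ('a \<Rightarrow> 'a) \<Rightarrow> complex" where
  "lie_trace L f = (let b = (SOME b. \<not> cdependent b \<and> cspan b = lie_carrier L)
                    in \<Sum>v\<in>b. crepresentation b (f v) v)"

definition killing_form :: "'a::complex_vector lie \<Rightarrow> 'a \<Rightarrow> 'a \<Rightarrow> complex" where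
  "killing_form L x y = lie_trace L (\<lambda>z. lie_bracket L x (lie_bracket L y z))"

definition B_isometry :: "'a::complex_vector lie \<Rightarrow> ('a \<Rightarrow> 'a) \<Rightarrow> bool" where
  "B_isometry L f \<longleftrightarrow> bij_betw f (lie_carrier L) (lie_carrier L) \<and>
     (\<forall>x\<in>lie_carrier L. \<forall>y\<in>lie_carrier L. f (x + y) = f x + f y) \<and>
     (\<forall>a. \<forall>x\<in>lie_carrier L. f (a *\<^sub>C x) = a *\<^sub>C f x) \<and>
     (\<forall>x\<in>lie_carrier L. \<forall>y\<in>lie_carrier L. killing_form L (f x) (f y) = killing_form L x y)"


section \<open>Left-invariant Hermitian geometry\<close>

text \<open>
  A real tangent vector at the identity of the complex Lie group is an element of its complex Lie
  algebra, the complex structure \<open>J\<close> being multiplication by \<open>\<i>\<close>. A left-invariant Hermitian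
  metric is a Hermitian inner product \<open>h\<close> (linear in the first argument), and the underlying
  Riemannian metric is its real part.
\<close>

definition hermitian_metric :: "'a::complex_vector lie \<Rightarrow> ('a \<Rightarrow> 'a \<Rightarrow> complex) \<Rightarrow> bool" where
  "hermitian_metric L h \<longleftrightarrow>
     (\<forall>x\<in>lie_carrier L. \<forall>y\<in>lie_carrier L. \<forall>z\<in>lie_carrier L. h (x + y) z = h x z + h y z) \<and>
     (\<forall>a. \<forall>x\<in>lie_carrier L. \<forall>y\<in>lie_carrier L. h (a *\<^sub>C x) y = a * h x y) \<and>
     (\<forall>x\<in>lie_carrier L. \<forall>y\<in>lie_carrier L. h y x = cnj (h x y)) \<and>
     (\<forall>x\<in>lie_carrier L. x \<noteq> 0 \<longrightarrow> Re (h x x) > 0)"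

definition cstruct :: "'a::complex_vector \<Rightarrow> 'a" where
  "cstruct x = \<i> *\<^sub>C x"

definition riem :: "('a \<Rightarrow> 'a \<Rightarrow> complex) \<Rightarrow> 'a \<Rightarrow> 'a \<Rightarrow> real" where
  "riem h x y = Re (h x y)"

text \<open>
  The Levi-Civita and Bismut connections of a left-invariant metric are left-invariant. A
  left-invariant linear connection is determined by its values \<open>D x y = \<nabla>\<^sub>x y\<close> on left-invariant
  vector fields, which are again left-invariant; these form an arbitrary real bilinear map on the
  Lie algebra. Below, covariant derivatives of left-invariant tensors are evaluated on
  left-invariant fields, so all terms that differentiate a (constant) function vanish.
\<close>

definition linear_connection :: "'a::complex_vector lie \<Rightarrow> ('a \<Rightarrow> 'a \<Rightarrow> 'a) \<Rightarrow> bool" where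
  "linear_connection L D \<longleftrightarrow>
     (\<forall>x\<in>lie_carrier L. \<forall>y\<in>lie_carrier L. D x y \<in> lie_carrier L) \<and>
     (\<forall>x\<in>lie_carrier L. \<forall>y\<in>lie_carrier L. \<forall>z\<in>lie_carrier L. D (x + y) z = D x z + D y z) \<and>
     (\<forall>x\<in>lie_carrier L. \<forall>y\<in>lie_carrier L. \<forall>z\<in>lie_carrier L. D x (y + z) = D x y + D x z) \<and>
     (\<forall>t. \<forall>x\<in>lie_carrier L. \<forall>y\<in>lie_carrier L. D (complex_of_real t *\<^sub>C x) y = complex_of_real t *\<^sub>C D x y) \<and>
     (\<forall>t. \<forall>x\<in>lie_carrier L. \<forall>y\<in>lie_carrier L. D x (complex_of_real t *\<^sub>C y) = complex_of_real t *\<^sub>C D x y)"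

definition metric_parallel ::
  "'a::complex_vector lie \<Rightarrow> ('a \<Rightarrow> 'a \<Rightarrow> complex) \<Rightarrow> ('a \<Rightarrow> 'a \<Rightarrow> 'a) \<Rightarrow> bool" where
  "metric_parallel L h D \<longleftrightarrow>
     (\<forall>x\<in>lie_carrier L. \<forall>y\<in>lie_carrier L. \<forall>z\<in>lie_carrier L. riem h (D x y) z + riem h y (D x z) = 0)"

definition cstruct_parallel :: "'a::complex_vector lie \<Rightarrow> ('a \<Rightarrow> 'a \<Rightarrow> 'a) \<Rightarrow> bool" where
  "cstruct_parallel L D \<longleftrightarrow>
     (\<forall>x\<in>lie_carrier L. \<forall>y\<in>lie_carrier L. D x (cstruct y) = cstruct (D x y))"

definition torsion :: "'a::complex_vector lie \<Rightarrow> ('a \<Rightarrow> 'a \<Rightarrow> 'a) \<Rightarrow> 'a \<Rightarrow> 'a \<Rightarrow> 'a" where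
  "torsion L D x y = D x y - D y x - lie_bracket L x y"

definition curvature :: "'a::complex_vector lie \<Rightarrow> ('a \<Rightarrow> 'a \<Rightarrow> 'a) \<Rightarrow> 'a \<Rightarrow> 'a \<Rightarrow> 'a \<Rightarrow> 'a" where
  "curvature L D x y z = D x (D y z) - D y (D x z) - D (lie_bracket L x y) z"

definition torsion_skew ::
  "'a::complex_vector lie \<Rightarrow> ('a \<Rightarrow> 'a \<Rightarrow> complex) \<Rightarrow> ('a \<Rightarrow> 'a \<Rightarrow> 'a) \<Rightarrow> bool" where
  "torsion_skew L h D \<longleftrightarrow>
     (\<forall>x\<in>lie_carrier L. \<forall>y\<in>lie_carrier L. \<forall>z\<in>lie_carrier L.
        riem h (torsion L D y x) z = - riem h (torsion L D x y) z \<and>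
        riem h (torsion L D x z) y = - riem h (torsion L D x y) z)"

definition bismut_connection ::
  "'a::complex_vector lie \<Rightarrow> ('a \<Rightarrow> 'a \<Rightarrow> complex) \<Rightarrow> ('a \<Rightarrow> 'a \<Rightarrow> 'a) \<Rightarrow> bool" where
  "bismut_connection L h D \<longleftrightarrow>
     linear_connection L D \<and> metric_parallel L h D \<and> cstruct_parallel L D \<and> torsion_skew L h D"

definition torsion_parallel :: "'a::complex_vector lie \<Rightarrow> ('a \<Rightarrow> 'a \<Rightarrow> 'a) \<Rightarrow> bool" where
  "torsion_parallel L D \<longleftrightarrow>
     (\<forall>w\<in>lie_carrier L. \<forall>x\<in>lie_carrier L. \<forall>y\<in>lie_carrier L.
        D w (torsion L D x y) - torsion L D (D w x) y - torsion L D x (D w y) = 0)"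

text \<open>The connection is unique on the carrier, see \<open>bismut_connection_unique\<close> below.\<close>

definition BTP :: "'a::complex_vector lie \<Rightarrow> ('a \<Rightarrow> 'a \<Rightarrow> complex) \<Rightarrow> bool" where
  "BTP L h \<longleftrightarrow> (\<exists>D. bismut_connection L h D \<and> torsion_parallel L D)"

text \<open>Closedness of the fundamental form \<open>\<omega>(x,y) = g(J x, y)\<close>; the exterior derivative of a
  left-invariant form is the Chevalley-Eilenberg differential.\<close>

definition fundamental_form :: "('a::complex_vector \<Rightarrow> 'a \<Rightarrow> complex) \<Rightarrow> 'a \<Rightarrow> 'a \<Rightarrow> real" where
  "fundamental_form h x y = riem h (cstruct x) y"

definition kaehler :: "'a::complex_vector lie \<Rightarrow> ('a \<Rightarrow> 'a \<Rightarrow> complex) \<Rightarrow> bool" where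
  "kaehler L h \<longleftrightarrow>
     (\<forall>x\<in>lie_carrier L. \<forall>y\<in>lie_carrier L. \<forall>z\<in>lie_carrier L.
        - fundamental_form h (lie_bracket L x y) z + fundamental_form h (lie_bracket L x z) y
        - fundamental_form h (lie_bracket L y z) x = 0)"

definition levi_civita_connection ::
  "'a::complex_vector lie \<Rightarrow> ('a \<Rightarrow> 'a \<Rightarrow> complex) \<Rightarrow> ('a \<Rightarrow> 'a \<Rightarrow> 'a) \<Rightarrow> bool" where
  "levi_civita_connection L h D \<longleftrightarrow> linear_connection L D \<and> metric_parallel L h D \<and>
     (\<forall>x\<in>lie_carrier L. \<forall>y\<in>lie_carrier L. torsion L D x y = 0)"

definition flat :: "'a::complex_vector lie \<Rightarrow> ('a \<Rightarrow> 'a \<Rightarrow> complex) \<Rightarrow> bool" where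
  "flat L h \<longleftrightarrow> (\<exists>D. levi_civita_connection L h D \<and>
     (\<forall>x\<in>lie_carrier L. \<forall>y\<in>lie_carrier L. \<forall>z\<in>lie_carrier L. curvature L D x y z = 0))"


section \<open>Consistency of the definitions\<close>

lemma bismut_connection_unique:
  assumes L: "complex_lie_algebra L" and h: "hermitian_metric L h"
    and D: "bismut_connection L h D" and E: "bismut_connection L h E"
    and x: "x \<in> lie_carrier L" and y: "y \<in> lie_carrier L"
  shows "D x y = E x y"
proof -
  define V where "V = lie_carrier L"
  define A where "A x y = D x y - E x y" for x y
  interpret complex_lie_algebra L by (fact L)
  have diff: "u - v \<in> V" if "u \<in> V" "v \<in> V" for u v
    using that subspace_carrier complex_vector.subspace_diff unfolding V_def by blast
  have hadd: "riem h (u + v) w = riem h u w + riem h v w" if "u \<in> V" "v \<in> V" "w \<in> V" for u v w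
  proof -
    have "h (u + v) w = h u w + h v w" using h that unfolding hermitian_metric_def V_def by blast
    then show ?thesis by (simp add: riem_def)
  qed
  have hdiff: "riem h (u - v) w = riem h u w - riem h v w" if "u \<in> V" "v \<in> V" "w \<in> V" for u v w
    using hadd[of "u - v" v w] diff that by simp
  have hsym: "riem h u v = riem h v u" if "u \<in> V" "v \<in> V" for u v
  proof -
    have "h v u = cnj (h u v)" using h that unfolding hermitian_metric_def V_def by blast
    then show ?thesis by (simp add: riem_def)
  qed
  have DV: "D u v \<in> V" "E u v \<in> V" if "u \<in> V" "v \<in> V" for u v
    using that D[unfolded bismut_connection_def linear_connection_def]
      E[unfolded bismut_connection_def linear_connection_def] unfolding V_def by simp_all
  have AV: "A u v \<in> V" if "u \<in> V" "v \<in> V" for u v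
    using DV diff that unfolding A_def by blast
  have skew1: "riem h (A u v) w = - riem h (A u w) v" if "u \<in> V" "v \<in> V" "w \<in> V" for u v w
  proof -
    have "riem h (D u v) w + riem h v (D u w) = 0" "riem h (E u v) w + riem h v (E u w) = 0"
      using D E that unfolding bismut_connection_def metric_parallel_def V_def by blast+
    then show ?thesis
      using that by (simp add: A_def hdiff DV hsym[of v])
  qed
  have TV: "torsion L D u v \<in> V" "torsion L E u v \<in> V" if "u \<in> V" "v \<in> V" for u v
    using that bracket_closed[of u v] unfolding torsion_def by (simp_all add: V_def[symmetric] diff DV)
  have tor: "torsion L D u v - torsion L E u v = A u v - A v u" for u v
    by (simp add: torsion_def A_def algebra_simps)
  have skew2: "riem h (A u v - A v u) w = - riem h (A u w - A w u) v"
    if "u \<in> V" "v \<in> V" "w \<in> V" for u v w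
  proof -
    have "riem h (torsion L D u w) v = - riem h (torsion L D u v) w"
      "riem h (torsion L E u w) v = - riem h (torsion L E u v) w"
      using D E that unfolding bismut_connection_def torsion_skew_def V_def by blast+
    then show ?thesis
      unfolding tor[symmetric] using that by (simp add: hdiff TV)
  qed
  have skew3: "riem h (A v u) w = - riem h (A w u) v" if "u \<in> V" "v \<in> V" "w \<in> V" for u v w
    using skew2[OF that] skew1[OF that] that by (simp add: hdiff AV)
  have JV: "cstruct u \<in> V" if "u \<in> V" for u
    using that subspace_carrier complex_vector.subspace_scale unfolding V_def cstruct_def by blast
  have JJ: "cstruct (cstruct u) = - u" for u :: 'a
  proof -
    have "\<i> *\<^sub>C \<i> *\<^sub>C u = (- 1) *\<^sub>C u" by (simp add: scaleC_scaleC)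
    also have "\<dots> = - u" by simp
    finally show ?thesis by (simp add: cstruct_def)
  qed
  have AJ: "A u (cstruct v) = cstruct (A u v)" if "u \<in> V" "v \<in> V" for u v
  proof -
    have "D u (cstruct v) = cstruct (D u v)" "E u (cstruct v) = cstruct (E u v)"
      using D E that unfolding bismut_connection_def cstruct_parallel_def V_def by blast+
    then show ?thesis
      by (simp add: A_def cstruct_def complex_vector.scale_right_diff_distrib)
  qed
  have Jskew: "riem h (cstruct u) w = - riem h u (cstruct w)" if "u \<in> V" "w \<in> V" for u w
  proof -
    have 1: "h (cstruct u) w = \<i> * h u w" "h (cstruct w) u = \<i> * h w u" "h w u = cnj (h u w)"
      using h that unfolding hermitian_metric_def V_def cstruct_def by blast+
    show ?thesis using hsym[of u "cstruct w"] JV that by (simp add: riem_def 1)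
  qed
  define a where "a u v w = riem h (A u v) w" for u v w
  have a1: "a u v w = - a u w v" and a2: "a v u w = - a w u v"
    if "u \<in> V" "v \<in> V" "w \<in> V" for u v w
    using skew1[OF that] skew3[OF that] by (auto simp: a_def)
  have aJ: "a u (cstruct v) w = - a u v (cstruct w)" if "u \<in> V" "v \<in> V" "w \<in> V" for u v w
    using that by (simp add: a_def AJ Jskew AV)
  have a3: "a u v w = - a v u w" if "u \<in> V" "v \<in> V" "w \<in> V" for u v w
    using a1[of u v w] a2[of w u v] a1[of v w u] that by simp
  have aJ0: "a u (cstruct v) w = 0" if "u \<in> V" "v \<in> V" "w \<in> V" for u v w
  proof -
    have "a u (cstruct v) w = - a u v (cstruct w)" using aJ that by blast
    also have "\<dots> = a v u (cstruct w)" using a3[of u v "cstruct w"] JV that by simp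
    also have "\<dots> = - a v (cstruct u) w" using aJ[of v u w] that by simp
    also have "\<dots> = a v w (cstruct u)" using a1[of v "cstruct u" w] JV that by simp
    also have "\<dots> = - a w v (cstruct u)" using a3[of v w "cstruct u"] JV that by simp
    also have "\<dots> = a w (cstruct v) u" using aJ[of w v u] that by simp
    also have "\<dots> = - a u (cstruct v) w" using a2[of w u "cstruct v"] a1[of w u "cstruct v"]
        a3[of u "cstruct v" w] a1[of "cstruct v" u w] a3[of w "cstruct v" u] JV that by simp
    finally show ?thesis by simp
  qed
  have zero: "a u v w = 0" if "u \<in> V" "v \<in> V" "w \<in> V" for u v w
  proof -
    have "a u (- v) w = 0" using aJ0[of u "cstruct v" w] JV that by (simp add: JJ)
    moreover have "- v \<in> V"
      using that subspace_carrier complex_vector.subspace_neg unfolding V_def by blast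
    ultimately have "riem h (A u w) (- v) = 0" using a1[of u "- v" w] that by (simp add: a_def)
    then have "riem h (- v) (A u w) = 0" using hsym[of "- v" "A u w"] AV \<open>- v \<in> V\<close> that by simp
    moreover have "riem h v (A u w) + riem h (- v) (A u w) = riem h 0 (A u w)"
      using hadd[of v "- v" "A u w"] AV \<open>- v \<in> V\<close> that by simp
    moreover have "riem h 0 (A u w) = 0"
      using hdiff[of v v "A u w"] AV that by simp
    ultimately have "a u w v = 0" using hsym[of v "A u w"] AV that by (simp add: a_def)
    then show ?thesis using a1[of u v w] that by simp
  qed
  have "A x y = 0"
  proof (rule ccontr)
    assume "A x y \<noteq> 0"
    then have "riem h (A x y) (A x y) > 0"
      using h AV[of x y] x y unfolding hermitian_metric_def riem_def V_def by blast
    then show False using zero[of x y "A x y"] AV[of x y] x y by (simp add: a_def V_def)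
  qed
  then show ?thesis by (simp add: A_def)
qed

lemma product_lie_complex_lie_algebra:
  assumes L: "\<And>i. i < r \<Longrightarrow> complex_lie_algebra (L i)"
  shows "complex_lie_algebra (product_lie k r L)"
proof -
  define V where "V = lie_carrier (product_lie k r L)"
  have mem: "p \<in> V \<longleftrightarrow>
      (\<forall>j\<ge>k. fst p j = 0) \<and> (\<forall>i<r. snd p i \<in> lie_carrier (L i)) \<and> (\<forall>i\<ge>r. snd p i = 0)" for p
    by (cases p) (auto simp: V_def product_lie_def euclidean_lie_def)
  have br: "lie_bracket (product_lie k r L) p q =
      (0, \<lambda>i. if i < r then lie_bracket (L i) (snd p i) (snd q i) else 0)" for p q
    by (cases p; cases q) (auto simp: product_lie_def euclidean_lie_def zero_fun_def)
  have sub: "csubspace (lie_carrier (L i))" if "i < r" for i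
    using L[OF that] by (rule complex_lie_algebra.subspace_carrier)
  have subV: "csubspace V"
    unfolding complex_vector.subspace_def
    by (auto simp: mem scaleC_prod_def scaleC_fun_def
        intro: complex_vector.subspace_0[OF sub] complex_vector.subspace_add[OF sub]
          complex_vector.subspace_scale[OF sub])
  have "\<forall>i. \<exists>b. i < r \<longrightarrow> finite b \<and> cspan b = lie_carrier (L i)"
    using L complex_lie_algebra.finite_dim by blast
  then obtain b where b: "finite (b i)" "cspan (b i) = lie_carrier (L i)" if "i < r" for i
    by metis
  define e where "e j = (\<lambda>m. if m = j then 1 else 0 :: complex, 0 :: nat \<Rightarrow> 'a)" for j :: nat
  define \<iota> where "\<iota> i v = (0 :: nat \<Rightarrow> complex, \<lambda>m. if m = i then v else 0 :: 'a)" for i :: nat and v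
  define B where "B = e ` {..<k} \<union> (\<Union>i<r. \<iota> i ` b i)"
  have "finite B" using b(1) by (auto simp: B_def)
  have "e j \<in> V" if "j < k" for j
    using that complex_vector.subspace_0[OF sub] by (auto simp: mem e_def)
  moreover have "\<iota> i v \<in> V" if "i < r" "v \<in> b i" for i v
  proof -
    have "v \<in> lie_carrier (L i)" using complex_vector.span_base[of v "b i"] b(2) that by simp
    then show ?thesis using that complex_vector.subspace_0[OF sub] by (auto simp: mem \<iota>_def)
  qed
  ultimately have "B \<subseteq> V" by (auto simp: B_def)
  then have "cspan B \<subseteq> V" using subV by (rule complex_vector.span_minimal)
  moreover have "p \<in> cspan B" if p: "p \<in> V" for p
  proof -
    have \<iota>: "\<iota> i v \<in> cspan B" if "i < r" "v \<in> lie_carrier (L i)" for i v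
    proof -
      have "v \<in> cspan (b i)" using b(2) that by simp
      then show ?thesis
      proof (induction rule: complex_vector.span_induct_alt)
        case base
        have "\<iota> i 0 = 0" by (simp add: \<iota>_def zero_prod_def zero_fun_def)
        then show ?case by (simp add: complex_vector.span_zero)
      next
        case (step c x y)
        have "\<iota> i (c *\<^sub>C x + y) = c *\<^sub>C \<iota> i x + \<iota> i y"
          by (simp add: \<iota>_def prod_eq_iff fun_eq_iff scaleC_prod_def scaleC_fun_def)
        moreover have "\<iota> i x \<in> cspan B"
          using step that by (intro complex_vector.span_base) (auto simp: B_def)
        ultimately show ?case
          using step by (simp add: complex_vector.span_add complex_vector.span_scale)
      qed
    qed
    have fs: "fst (sum g A) = sum (\<lambda>x. fst (g x)) A" "snd (sum g A) = sum (\<lambda>x. snd (g x)) A"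
      for g :: "nat \<Rightarrow> (nat \<Rightarrow> complex) \<times> (nat \<Rightarrow> 'a)" and A
      by (induction A rule: infinite_finite_induct) auto
    have fa: "sum g A m = (\<Sum>x\<in>A. g x m)" for g :: "nat \<Rightarrow> nat \<Rightarrow> 'c::comm_monoid_add" and A m
      by (induction A rule: infinite_finite_induct) auto
    have "p = (\<Sum>j<k. fst p j *\<^sub>C e j) + (\<Sum>i<r. \<iota> i (snd p i))"
    proof (rule prod_eqI)
      show "fst p = fst ((\<Sum>j<k. fst p j *\<^sub>C e j) + (\<Sum>i<r. \<iota> i (snd p i)))"
      proof
        fix m
        have "(\<Sum>j<k. fst p j * (if m = j then 1 else 0)) = fst p m"
          using p by (cases "m < k") (auto simp: mem if_distrib cong: if_cong)
        then show "fst p m = fst ((\<Sum>j<k. fst p j *\<^sub>C e j) + (\<Sum>i<r. \<iota> i (snd p i))) m"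
          by (simp add: fs fa e_def \<iota>_def scaleC_prod_def scaleC_fun_def scaleC_complex_def)
      qed
      show "snd p = snd ((\<Sum>j<k. fst p j *\<^sub>C e j) + (\<Sum>i<r. \<iota> i (snd p i)))"
      proof
        fix m
        have "(\<Sum>i<r. if m = i then snd p i else 0) = snd p m"
          using p by (cases "m < r") (auto simp: mem)
        then show "snd p m = snd ((\<Sum>j<k. fst p j *\<^sub>C e j) + (\<Sum>i<r. \<iota> i (snd p i))) m"
          by (simp add: fs fa e_def \<iota>_def scaleC_prod_def scaleC_fun_def)
      qed
    qed
    also have "\<dots> \<in> cspan B"
      using p by (intro complex_vector.span_add complex_vector.span_sum complex_vector.span_scale
          complex_vector.span_base \<iota>) (auto simp: B_def mem)
    finally show ?thesis .
  qed
  ultimately have "cspan B = V" by blast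
  with \<open>finite B\<close> have fin: "\<exists>b. finite b \<and> cspan b = V" by blast
  show ?thesis
  proof (unfold_locales, goal_cases)
    case 1 show ?case using subV by (simp add: V_def)
  next
    case 2 show ?case using fin by (simp add: V_def)
  next
    case 3 then show ?case
      unfolding V_def[symmetric] mem br by (simp add: complex_lie_algebra.bracket_closed[OF L])
  next
    case 4 then show ?case
      unfolding V_def[symmetric] mem br
      by (auto simp: fun_eq_iff complex_lie_algebra.bracket_add_left[OF L])
  next
    case 5 then show ?case
      unfolding V_def[symmetric] mem br
      by (auto simp: fun_eq_iff complex_lie_algebra.bracket_add_right[OF L])
  next
    case 6 then show ?case
      unfolding V_def[symmetric] mem br
      by (auto simp: fun_eq_iff scaleC_prod_def scaleC_fun_def
          complex_lie_algebra.bracket_scale_left[OF L])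
  next
    case 7 then show ?case
      unfolding V_def[symmetric] mem br
      by (auto simp: fun_eq_iff scaleC_prod_def scaleC_fun_def
          complex_lie_algebra.bracket_scale_right[OF L])
  next
    case 8 then show ?case
      unfolding V_def[symmetric] mem br
      by (auto simp: fun_eq_iff zero_prod_def complex_lie_algebra.bracket_self[OF L])
  next
    case 9 then show ?case
      unfolding V_def[symmetric] mem br
      by (auto simp: fun_eq_iff zero_prod_def complex_lie_algebra.jacobi[OF L])
  qed
qed

end

theory Submission
  imports Defs "HOL-Computational_Algebra.Fundamental_Theorem_Algebra"
begin

text \<open>
  On a complex Lie group the Bismut connection of a left-invariant Hermitian metric is
  \<open>D w = ad w - (ad w)\<^sup>*\<close> (lemma \<open>bismut_connection_is_ad_minus_adjoint\<close>). Sorting the equation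
  \<open>D T = 0\<close> by complex type shows that a BTP metric makes every adjoint \<open>(ad w)\<^sup>*\<close> a derivation
  of the Lie algebra (lemma \<open>BTP_adjoint_derivations\<close>). All the rest follows from this property.

  A derivation preserves the centre and each perfect ideal. If \<open>N\<close> is one of these and \<open>m\<close> commutes with
  \<open>N\<close>, then \<open>n' = (ad m)\<^sup>* n\<close> lies in \<open>N\<close> for \<open>n \<in> N\<close>, and its square norm \<open>h [m, n'] n\<close> vanishes.
  So \<open>N\<close> is orthogonal to the image of \<open>ad m\<close>. Applied to the factors, each of which is central or
  spanned by its brackets, this gives the orthogonal splitting.

  On a simple Lie algebra the adjoints are inner, \<open>(ad w)\<^sup>* = ad (\<sigma> w)\<close>, for a conjugate linear
  involution \<open>\<sigma>\<close> that reverses brackets (lemma \<open>simple_adjoint_inner\<close>). If \<open>\<tau>\<close> is the involution of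
  a second metric, \<open>f = \<sigma> \<circ> \<tau>\<close> is an automorphism, and therefore preserves the Killing form.
  Schur's lemma gives \<open>h x y = c g (f x) y\<close>, and positivity of both metrics makes \<open>c\<close> real
  (lemma \<open>simple_metrics_proportional_up_to_automorphism\<close>).
\<close>

section \<open>Hermitian forms on a finite-dimensional subspace\<close>

locale hermitian_space =
  fixes V :: "'a::complex_vector set" and h :: "'a \<Rightarrow> 'a \<Rightarrow> complex"
  assumes subspace: "csubspace V"
    and finite_spanned: "\<exists>b. finite b \<and> cspan b = V"
    and add_left: "\<lbrakk>x \<in> V; y \<in> V; z \<in> V\<rbrakk> \<Longrightarrow> h (x + y) z = h x z + h y z"
    and scale_left: "\<lbrakk>x \<in> V; y \<in> V\<rbrakk> \<Longrightarrow> h (a *\<^sub>C x) y = a * h x y"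
    and hermitian: "\<lbrakk>x \<in> V; y \<in> V\<rbrakk> \<Longrightarrow> h y x = cnj (h x y)"
    and positive: "\<lbrakk>x \<in> V; x \<noteq> 0\<rbrakk> \<Longrightarrow> Re (h x x) > 0"
begin

lemma zero_in [simp, intro]: "0 \<in> V"
  and add_in [simp, intro]: "x \<in> V \<Longrightarrow> y \<in> V \<Longrightarrow> x + y \<in> V"
  and diff_in [simp, intro]: "x \<in> V \<Longrightarrow> y \<in> V \<Longrightarrow> x - y \<in> V"
  and minus_in [simp, intro]: "x \<in> V \<Longrightarrow> - x \<in> V"
  and scale_in [simp, intro]: "x \<in> V \<Longrightarrow> a *\<^sub>C x \<in> V"
  using subspace by (auto intro: complex_vector.subspace_0 complex_vector.subspace_add
      complex_vector.subspace_diff complex_vector.subspace_neg complex_vector.subspace_scale)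

lemma diff_left: "\<lbrakk>x \<in> V; y \<in> V; z \<in> V\<rbrakk> \<Longrightarrow> h (x - y) z = h x z - h y z"
  using add_left[of "x - y" y z] by simp

lemma zero_left: "y \<in> V \<Longrightarrow> h 0 y = 0"
  using diff_left[of y y y] by simp

lemma minus_left: "\<lbrakk>x \<in> V; y \<in> V\<rbrakk> \<Longrightarrow> h (- x) y = - h x y"
  using diff_left[of 0 x y] by (simp add: zero_left)

lemma add_right: "\<lbrakk>x \<in> V; y \<in> V; z \<in> V\<rbrakk> \<Longrightarrow> h z (x + y) = h z x + h z y"
  using hermitian[of "x + y" z] hermitian[of x z] hermitian[of y z] add_left[of x y z] by simp

lemma diff_right: "\<lbrakk>x \<in> V; y \<in> V; z \<in> V\<rbrakk> \<Longrightarrow> h z (x - y) = h z x - h z y"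
  using add_right[of "x - y" y z] by simp

lemma scale_right: "\<lbrakk>x \<in> V; y \<in> V\<rbrakk> \<Longrightarrow> h x (a *\<^sub>C y) = cnj a * h x y"
  using hermitian[of "a *\<^sub>C y" x] hermitian[of y x] scale_left[of y x a] by simp

lemma zero_right: "y \<in> V \<Longrightarrow> h y 0 = 0"
  using diff_right[of y y y] by simp

lemma minus_right: "\<lbrakk>x \<in> V; y \<in> V\<rbrakk> \<Longrightarrow> h x (- y) = - h x y"
  using diff_right[of 0 y x] by (simp add: zero_right)

lemmas sesquilinear = add_left add_right diff_left diff_right scale_left scale_right
  minus_left minus_right zero_left zero_right

lemma self_zeroD: "x \<in> V \<Longrightarrow> h x x = 0 \<Longrightarrow> x = 0"
  using positive[of x] by fastforce

lemma eqI_left: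
  assumes "x \<in> V" "y \<in> V" "\<And>z. z \<in> V \<Longrightarrow> h x z = h y z"
  shows "x = y"
  using self_zeroD[of "x - y"] assms by (simp add: diff_left)

lemma eqI_right:
  assumes "x \<in> V" "y \<in> V" "\<And>z. z \<in> V \<Longrightarrow> h z x = h z y"
  shows "x = y"
  using self_zeroD[of "x - y"] assms by (simp add: diff_right)

lemma self_real: "x \<in> V \<Longrightarrow> h x x = complex_of_real (Re (h x x))"
  using hermitian[of x x] by (simp add: complex_eq_iff)

lemma sum_left: "\<lbrakk>\<And>i. i \<in> A \<Longrightarrow> f i \<in> V; y \<in> V\<rbrakk> \<Longrightarrow> h (sum f A) y = (\<Sum>i\<in>A. h (f i) y)"
  by (induction A rule: infinite_finite_induct)
    (auto simp: zero_left add_left complex_vector.subspace_sum[OF subspace])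

lemma sum_right: "\<lbrakk>\<And>i. i \<in> A \<Longrightarrow> f i \<in> V; y \<in> V\<rbrakk> \<Longrightarrow> h y (sum f A) = (\<Sum>i\<in>A. h y (f i))"
  by (induction A rule: infinite_finite_induct)
    (auto simp: zero_right add_right complex_vector.subspace_sum[OF subspace])

text \<open>
  The Riesz representation theorem, by induction on the spanning set. Passing from the span \<open>U\<close> of
  \<open>b\<close> to the span of \<open>insert a b\<close>, subtract from \<open>a\<close> its projection to \<open>U\<close>, which is the vector of \<open>U\<close>
  that represents \<open>v \<mapsto> h v a\<close>, and correct the representing vector by a multiple of the remainder,
  which is orthogonal to \<open>U\<close>.
\<close>

lemma riesz_on_span:
  assumes "finite b" "b \<subseteq> V"
    and add: "\<And>x y. x \<in> V \<Longrightarrow> y \<in> V \<Longrightarrow> \<phi> (x + y) = \<phi> x + \<phi> y"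
    and scale: "\<And>a x. x \<in> V \<Longrightarrow> \<phi> (a *\<^sub>C x) = a * \<phi> x"
  shows "\<exists>u \<in> cspan b. \<forall>v \<in> cspan b. h v u = \<phi> v"
  using assms
proof (induction b arbitrary: \<phi> rule: finite_induct)
  case empty
  have "\<phi> 0 = 0" using empty(3)[of 0 0] by simp
  then show ?case by (simp add: zero_left)
next
  case (insert a b)
  have a: "a \<in> V" and b: "b \<subseteq> V" using insert.prems(1) by auto
  have span_V: "cspan b \<subseteq> V" using b subspace by (rule complex_vector.span_minimal)
  obtain u where u: "u \<in> cspan b" "\<And>v. v \<in> cspan b \<Longrightarrow> h v u = \<phi> v"
    using insert.IH[OF b insert.prems(2,3)] by blast
  obtain p where p: "p \<in> cspan b" "\<And>v. v \<in> cspan b \<Longrightarrow> h v p = h v a"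
    using insert.IH[OF b, of "\<lambda>v. h v a"] a by (auto simp: add_left scale_left)
  define e where "e = a - p"
  have V: "u \<in> V" "p \<in> V" "e \<in> V" using u p a span_V by (auto simp: e_def)
  have perp: "h v e = 0" if "v \<in> cspan b" for v
    using p(2)[OF that] that a V span_V by (auto simp: e_def diff_right)
  define t where "t = cnj ((\<phi> e - h e u) / h e e)"
  have in_span: "x \<in> cspan (insert a b)" if "x \<in> cspan b" for x
    using that complex_vector.span_mono[of b "insert a b"] by auto
  have "u + t *\<^sub>C e \<in> cspan (insert a b)"
    unfolding e_def using u p in_span
    by (intro complex_vector.span_add complex_vector.span_scale complex_vector.span_diff)
      (auto intro: complex_vector.span_base)
  moreover have "h v (u + t *\<^sub>C e) = \<phi> v" if v: "v \<in> cspan (insert a b)" for v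
  proof -
    obtain s where s: "v - s *\<^sub>C a \<in> cspan b"
      using v by (auto simp: complex_vector.span_breakdown_eq)
    define w where "w = v - s *\<^sub>C a + s *\<^sub>C p"
    have w: "w \<in> cspan b"
      unfolding w_def using s p by (intro complex_vector.span_add complex_vector.span_scale)
    have wV: "w \<in> V" using w span_V by auto
    have v_eq: "v = w + s *\<^sub>C e"
      by (simp add: w_def e_def complex_vector.scale_right_diff_distrib)
    have he: "h e u + cnj t * h e e = \<phi> e"
    proof (cases "e = 0")
      case True
      then show ?thesis using insert.prems(2)[of 0 0] V by (simp add: zero_left)
    next
      case False
      then have "h e e \<noteq> 0" using self_zeroD V by blast
      then show ?thesis by (simp add: t_def)
    qed
    have "h v (u + t *\<^sub>C e) = h w u + s * (h e u + cnj t * h e e)"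
      using V wV perp[OF w] by (simp add: v_eq sesquilinear algebra_simps)
    also have "\<dots> = \<phi> v"
      using V wV u(2)[OF w] by (simp add: v_eq he insert.prems(2,3))
    finally show ?thesis .
  qed
  ultimately show ?case by blast
qed

text \<open>This turns the comparison of two metrics into a question about eigenvectors of an operator.\<close>

lemma form_represented_by_operator:
  assumes add: "\<And>x y z. \<lbrakk>x \<in> V; y \<in> V; z \<in> V\<rbrakk> \<Longrightarrow> q (x + y) z = q x z + q y z"
    and scale: "\<And>a x y. \<lbrakk>x \<in> V; y \<in> V\<rbrakk> \<Longrightarrow> q (a *\<^sub>C x) y = a * q x y"
    and sym: "\<And>x y. \<lbrakk>x \<in> V; y \<in> V\<rbrakk> \<Longrightarrow> q y x = cnj (q x y)"
  obtains P where "\<And>x. x \<in> V \<Longrightarrow> P x \<in> V"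
    and "\<And>x y. \<lbrakk>x \<in> V; y \<in> V\<rbrakk> \<Longrightarrow> P (x + y) = P x + P y"
    and "\<And>a x. x \<in> V \<Longrightarrow> P (a *\<^sub>C x) = a *\<^sub>C P x"
    and "\<And>x y. \<lbrakk>x \<in> V; y \<in> V\<rbrakk> \<Longrightarrow> h (P x) y = q x y"
proof -
  obtain b where b: "finite b" "cspan b = V" using finite_spanned by blast
  then have "b \<subseteq> V" using complex_vector.span_superset by blast
  then have "\<exists>u \<in> V. \<forall>v \<in> V. h v u = q v x" if "x \<in> V" for x
    using riesz_on_span[of b "\<lambda>v. q v x"] b that by (simp add: add scale)
  then obtain P where P: "\<And>x. x \<in> V \<Longrightarrow> P x \<in> V"
    "\<And>x v. \<lbrakk>x \<in> V; v \<in> V\<rbrakk> \<Longrightarrow> h v (P x) = q v x"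
    by metis
  have hP: "h (P x) y = q x y" if "x \<in> V" "y \<in> V" for x y
    using hermitian[of y "P x"] sym[of y x] P that by simp
  show thesis
  proof
    show "P (x + y) = P x + P y" if "x \<in> V" "y \<in> V" for x y
      using that P(1) by (intro eqI_left) (auto simp: hP add_left add)
    show "P (a *\<^sub>C x) = a *\<^sub>C P x" if "x \<in> V" for a x
      using that P(1) by (intro eqI_left) (auto simp: hP scale_left scale)
  qed (auto intro: P hP)
qed

end

section \<open>Eigenvectors and traces\<close>

lemma finite_family_dependent:
  fixes x :: "nat \<Rightarrow> 'a::complex_vector"
  assumes "finite b" "\<And>i. x i \<in> cspan b"
  obtains c where "\<exists>i \<le> card b. c i \<noteq> 0" "(\<Sum>i\<le>card b. c i *\<^sub>C x i) = 0"
proof (cases "inj_on x {..card b}")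
  case True
  define S where "S = x ` {..card b}"
  have "card S = Suc (card b)" using True by (simp add: S_def card_image)
  moreover have "S \<subseteq> cspan b" using assms(2) by (auto simp: S_def)
  ultimately have "cdependent S"
    using complex_vector.independent_span_bound[OF assms(1), of S] by fastforce
  then obtain u where u: "\<exists>v\<in>S. u v \<noteq> 0" "(\<Sum>v\<in>S. u v *\<^sub>C v) = 0"
    using complex_vector.dependent_finite[of S] by (auto simp: S_def)
  have "(\<Sum>i\<le>card b. u (x i) *\<^sub>C x i) = 0"
    using u(2) sum.reindex[OF True, of "\<lambda>v. u v *\<^sub>C v"] by (simp add: S_def)
  then show thesis using u(1) by (intro that[of "u \<circ> x"]) (auto simp: S_def)
next
  case False
  then obtain i j where ij: "i \<le> card b" "j \<le> card b" "i \<noteq> j" "x i = x j"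
    by (auto simp: inj_on_def)
  define c :: "nat \<Rightarrow> complex" where "c m = (if m = i then 1 else if m = j then -1 else 0)" for m
  have "(\<Sum>m\<le>card b. c m *\<^sub>C x m) = (\<Sum>m\<in>{i, j}. c m *\<^sub>C x m)"
    using ij by (intro sum.mono_neutral_right) (auto simp: c_def)
  also have "\<dots> = 0" using ij by (simp add: c_def)
  finally show thesis using ij by (intro that[of c]) (auto simp: c_def)
qed

text \<open>
  The iterates of a nonzero vector are linearly dependent, so some nonzero polynomial in \<open>T\<close>
  annihilates it. Splitting off linear factors one after the other, the last nonzero vector
  produced before the annihilation is an eigenvector.
\<close>

lemma invariant_subspace_eigenvector:
  assumes W: "csubspace W" and b: "finite b" "W \<subseteq> cspan b"
    and v: "v \<in> W" "v \<noteq> 0"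
    and TW: "\<And>x. x \<in> W \<Longrightarrow> T x \<in> W"
    and add: "\<And>x y. \<lbrakk>x \<in> W; y \<in> W\<rbrakk> \<Longrightarrow> T (x + y) = T x + T y"
    and scale: "\<And>a x. x \<in> W \<Longrightarrow> T (a *\<^sub>C x) = a *\<^sub>C T x"
  obtains c x where "x \<in> W" "x \<noteq> 0" "T x = c *\<^sub>C x"
proof -
  note W_in = complex_vector.subspace_0[OF W] complex_vector.subspace_add[OF W]
    complex_vector.subspace_scale[OF W]
  have T0: "T 0 = 0" using add[of 0 0] W_in by simp
  define act where "act p = fold_coeffs (\<lambda>a w. a *\<^sub>C v + T w) p 0" for p :: "complex poly"
  have act0: "act 0 = 0" by (simp add: act_def)
  have act_pCons: "act (pCons a p) = a *\<^sub>C v + T (act p)" for a p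
    by (cases "a = 0 \<and> p = 0")
      (auto simp: act_def T0 fold_coeffs_pCons_not_0_0_eq fold_coeffs_pCons_coeff_not_0_eq)
  have actW: "act p \<in> W" for p
    by (induction p) (auto simp: act0 act_pCons TW W_in v)
  have act_add: "act (p + q) = act p + act q" for p q
    by (induction p q rule: poly_induct2)
      (auto simp: act0 act_pCons add actW complex_vector.scale_left_distrib)
  have act_smult: "act (smult c p) = c *\<^sub>C act p" for c p
    by (induction p)
      (auto simp: act0 act_pCons scale add TW actW W_in v complex_vector.scale_right_distrib)
  have act_monom: "act (monom c i) = c *\<^sub>C (T ^^ i) v" for c i
  proof (induction i)
    case (Suc i)
    have "(T ^^ i) v \<in> W" for i by (induction i) (auto simp: TW v)
    then show ?case using Suc by (simp add: monom_Suc act_pCons scale)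
  qed (simp add: monom_0 act_pCons act0 T0)
  have act_sum: "act (sum f A) = (\<Sum>i\<in>A. act (f i))" for f and A :: "nat set"
    by (induction A rule: infinite_finite_induct) (auto simp: act0 act_add)
  have "(T ^^ i) v \<in> W" for i by (induction i) (auto simp: TW v)
  then obtain c where c: "\<exists>i \<le> card b. c i \<noteq> 0" "(\<Sum>i\<le>card b. c i *\<^sub>C (T ^^ i) v) = 0"
    using finite_family_dependent[of b "\<lambda>i. (T ^^ i) v"] b by blast
  define p where "p = (\<Sum>i\<le>card b. monom (c i) i)"
  have "p \<noteq> 0"
  proof
    assume "p = 0"
    have "c i = 0" if "i \<le> card b" for i
    proof -
      have "coeff p i = c i" using that by (simp add: p_def coeff_sum)
      then show ?thesis using \<open>p = 0\<close> by simp
    qed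
    then show False using c(1) by blast
  qed
  moreover have "act p = 0" using c(2) by (simp add: p_def act_sum act_monom)
  ultimately show thesis
  proof (induction "degree p" arbitrary: p rule: less_induct)
    case less
    show ?case
    proof (cases "degree p = 0")
      case True
      then obtain a where "p = [:a:]" by (rule degree_eq_zeroE)
      then show ?thesis using less.prems v by (simp add: act_pCons act0 T0)
    next
      case False
      then have "\<not> constant (poly p)" by (simp add: constant_degree)
      then obtain z where "poly p z = 0" using fundamental_theorem_of_algebra by blast
      then obtain q where q: "p = [:- z, 1:] * q" by (metis poly_eq_0_iff_dvd dvdE)
      have "q \<noteq> 0" using q less.prems(1) by auto
      then have deg: "degree q < degree p" using degree_mult_eq[of "[:- z, 1:]" q] by (simp add: q)
      have "act p = - z *\<^sub>C act q + T (act q)"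
        by (simp only: q mult_pCons_left mult_zero_left act_add act_smult act_pCons
            complex_vector.scale_zero_left add_0 add_0_right smult_1_left act0 T0)
      then have eig: "T (act q) = z *\<^sub>C act q" using less.prems(2) by (simp add: add_eq_0_iff)
      show ?thesis
      proof (cases "act q = 0")
        case True
        then show ?thesis using less.hyps[OF deg \<open>q \<noteq> 0\<close>] by blast
      next
        case False
        then show ?thesis using that[OF actW _ eig] by blast
      qed
    qed
  qed
qed

text \<open>Both traces expand to the same double sum of coordinates. Applied to \<open>f\<close> and \<open>A \<circ> f\<^sup>-\<^sup>1\<close>, this
  makes the trace invariant under conjugation.\<close>

lemma (in complex_lie_algebra) lie_trace_commute:
  assumes F: "\<And>x. x \<in> lie_carrier L \<Longrightarrow> F x \<in> lie_carrier L"
      "\<And>x y. \<lbrakk>x \<in> lie_carrier L; y \<in> lie_carrier L\<rbrakk> \<Longrightarrow> F (x + y) = F x + F y"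
      "\<And>a x. x \<in> lie_carrier L \<Longrightarrow> F (a *\<^sub>C x) = a *\<^sub>C F x"
    and G: "\<And>x. x \<in> lie_carrier L \<Longrightarrow> G x \<in> lie_carrier L"
      "\<And>x y. \<lbrakk>x \<in> lie_carrier L; y \<in> lie_carrier L\<rbrakk> \<Longrightarrow> G (x + y) = G x + G y"
      "\<And>a x. x \<in> lie_carrier L \<Longrightarrow> G (a *\<^sub>C x) = a *\<^sub>C G x"
    and H: "\<And>x. x \<in> lie_carrier L \<Longrightarrow> H x = F (G x)"
    and K: "\<And>x. x \<in> lie_carrier L \<Longrightarrow> K x = G (F x)"
  shows "lie_trace L H = lie_trace L K"
proof -
  let ?V = "lie_carrier L"
  define b where "b = (SOME b. \<not> cdependent b \<and> cspan b = ?V)"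
  obtain s where s: "finite s" "cspan s = ?V" using finite_dim by blast
  obtain b' where "b' \<subseteq> ?V" "\<not> cdependent b'" "?V \<subseteq> cspan b'"
    using complex_vector.maximal_independent_subset[of ?V] by blast
  then have "\<not> cdependent b' \<and> cspan b' = ?V"
    using complex_vector.span_minimal[OF _ subspace_carrier, of b'] by blast
  then have "\<not> cdependent b \<and> cspan b = ?V" unfolding b_def by (rule someI)
  then have b: "\<not> cdependent b" "cspan b = ?V" by auto
  have bV: "b \<subseteq> ?V" using b(2) complex_vector.span_superset by blast
  have fin: "finite b" using complex_vector.independent_span_bound[OF s(1) b(1)] bV s(2) by auto
  have composed: "crepresentation b (S (T v)) v
      = (\<Sum>u\<in>b. crepresentation b (T v) u * crepresentation b (S u) v)"
    if S: "\<And>x. x \<in> ?V \<Longrightarrow> S x \<in> ?V" "\<And>x y. \<lbrakk>x \<in> ?V; y \<in> ?V\<rbrakk> \<Longrightarrow> S (x + y) = S x + S y"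
      "\<And>a x. x \<in> ?V \<Longrightarrow> S (a *\<^sub>C x) = a *\<^sub>C S x" and T: "\<And>x. x \<in> ?V \<Longrightarrow> T x \<in> ?V" and v: "v \<in> b"
    for S T v
  proof -
    note V_in = complex_vector.subspace_0[OF subspace_carrier]
      complex_vector.subspace_scale[OF subspace_carrier] complex_vector.subspace_sum[OF subspace_carrier]
    have S_sum: "S (\<Sum>u\<in>A. c u *\<^sub>C u) = (\<Sum>u\<in>A. c u *\<^sub>C S u)" if "A \<subseteq> b" for A c
      using finite_subset[OF that fin] that
    proof (induction A rule: finite_induct)
      case empty
      show ?case using S(2)[of 0 0] V_in(1) by simp
    next
      case (insert u A)
      then show ?case
        using bV by (simp add: V_in S(2,3) subset_iff)
    qed
    have "T v \<in> cspan b" using T v bV b(2) by auto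
    then have "T v = (\<Sum>u\<in>b. crepresentation b (T v) u *\<^sub>C u)"
      using complex_vector.sum_representation_eq[OF b(1) _ fin order_refl] by simp
    then have "S (T v) = (\<Sum>u\<in>b. crepresentation b (T v) u *\<^sub>C S u)"
      using S_sum[OF order_refl] by metis
    moreover have "S u \<in> cspan b" if "u \<in> b" for u using S(1) that bV b(2) by auto
    ultimately show ?thesis
      by (simp add: complex_vector.representation_sum[OF b(1)] complex_vector.span_scale
          complex_vector.representation_scale[OF b(1)])
  qed
  have "(\<Sum>v\<in>b. crepresentation b (H v) v)
      = (\<Sum>v\<in>b. \<Sum>u\<in>b. crepresentation b (G v) u * crepresentation b (F u) v)"
    using bV by (intro sum.cong refl) (simp add: H composed[where S = F and T = G, OF F G(1)] subset_iff)
  also have "\<dots> = (\<Sum>u\<in>b. \<Sum>v\<in>b. crepresentation b (F u) v * crepresentation b (G v) u)"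
    by (subst sum.swap) (simp add: mult.commute)
  also have "\<dots> = (\<Sum>u\<in>b. crepresentation b (K u) u)"
    using bV by (intro sum.cong refl) (simp add: K composed[where S = G and T = F, OF G F(1)] subset_iff)
  finally show ?thesis by (simp add: lie_trace_def b_def)
qed

lemma (in complex_lie_algebra) bracket_anticommute:
  assumes "x \<in> lie_carrier L" "y \<in> lie_carrier L"
  shows "lie_bracket L x y = - lie_bracket L y x"
proof -
  have xy: "x + y \<in> lie_carrier L"
    using assms subspace_carrier complex_vector.subspace_add by blast
  have "lie_bracket L x x + lie_bracket L y x + (lie_bracket L x y + lie_bracket L y y)
      = lie_bracket L (x + y) (x + y)"
    using assms xy by (simp only: bracket_add_left bracket_add_right)
  then show ?thesis
    using assms xy by (simp add: bracket_self eq_neg_iff_add_eq_0 add.commute)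
qed

section \<open>The Bismut connection of a left-invariant metric\<close>

text \<open>
  A totally skew form that changes sign when \<open>J\<close> moves from its second to its third argument does so
  for any two arguments. Moving \<open>J\<close> once around all three arguments then gives the sign
  \<open>(-1)\<^sup>3\<close> but returns to the start, so the form vanishes.
\<close>

lemma skew_form_compatible_with_J_vanishes:
  fixes a :: "'a \<Rightarrow> 'a \<Rightarrow> 'a::complex_vector \<Rightarrow> real"
  assumes V: "csubspace V"
    and skew_23: "\<And>u v w. \<lbrakk>u \<in> V; v \<in> V; w \<in> V\<rbrakk> \<Longrightarrow> a u v w = - a u w v"
    and skew_13: "\<And>u v w. \<lbrakk>u \<in> V; v \<in> V; w \<in> V\<rbrakk> \<Longrightarrow> a u v w = - a w v u"
    and J: "\<And>u v w. \<lbrakk>u \<in> V; v \<in> V; w \<in> V\<rbrakk> \<Longrightarrow> a u (cstruct v) w = - a u v (cstruct w)"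
    and "u \<in> V" "v \<in> V" "w \<in> V"
  shows "a u v w = 0"
proof -
  have JV: "cstruct x \<in> V" if "x \<in> V" for x
    using that V by (simp add: cstruct_def complex_vector.subspace_scale)
  have J12: "a (cstruct u) v w = - a u (cstruct v) w" if "u \<in> V" "v \<in> V" "w \<in> V" for u v w
    using that J[of w v u] skew_13[of "cstruct u" v w] skew_13[of u "cstruct v" w] JV by simp
  have J13: "a (cstruct u) v w = - a u v (cstruct w)" if "u \<in> V" "v \<in> V" "w \<in> V" for u v w
    using that J12[of u w v] skew_23[of "cstruct u" v w] skew_23[of u v "cstruct w"] JV by simp
  have vanish: "a u (cstruct v) w = 0" if "u \<in> V" "v \<in> V" "w \<in> V" for u v w
    using that J12[of u v w] J13[of u v w] J[of u v w] by simp
  have "cstruct (cstruct (- v)) = (\<i> * \<i>) *\<^sub>C (- v)" by (simp only: cstruct_def scaleC_scaleC)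
  also have "\<dots> = v" by simp
  finally show ?thesis
    using vanish[of u "cstruct (- v)" w] assms(5-) JV V by (simp add: complex_vector.subspace_neg)
qed

locale hermitian_lie_algebra = complex_lie_algebra L for L :: "'a::complex_vector lie" +
  fixes h :: "'a \<Rightarrow> 'a \<Rightarrow> complex"
  assumes metric: "hermitian_metric L h"
begin

abbreviation carrier ("V") where "V \<equiv> lie_carrier L"

abbreviation bracket (infixl "\<bullet>" 80) where "x \<bullet> y \<equiv> lie_bracket L x y"

sublocale hermitian_space V h
proof
  show "h (x + y) z = h x z + h y z" if "x \<in> V" "y \<in> V" "z \<in> V" for x y z
    using metric that unfolding hermitian_metric_def by blast
  show "h (a *\<^sub>C x) y = a * h x y" if "x \<in> V" "y \<in> V" for a x y
    using metric that unfolding hermitian_metric_def by blast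
  show "h y x = cnj (h x y)" if "x \<in> V" "y \<in> V" for x y
    using metric that unfolding hermitian_metric_def by blast
  show "0 < Re (h x x)" if "x \<in> V" "x \<noteq> 0" for x
    using metric that unfolding hermitian_metric_def by blast
qed (fact subspace_carrier finite_dim)+

declare bracket_closed [simp, intro]

lemma bracket_zero [simp]: "x \<in> V \<Longrightarrow> x \<bullet> 0 = 0" "x \<in> V \<Longrightarrow> 0 \<bullet> x = 0"
  using bracket_add_right[of x 0 0] bracket_add_left[of 0 0 x] by auto

lemma bracket_diff_right: "\<lbrakk>x \<in> V; y \<in> V; z \<in> V\<rbrakk> \<Longrightarrow> x \<bullet> (y - z) = x \<bullet> y - x \<bullet> z"
  using bracket_add_right[of x "y - z" z] by simp

lemma bracket_diff_left: "\<lbrakk>x \<in> V; y \<in> V; z \<in> V\<rbrakk> \<Longrightarrow> (x - y) \<bullet> z = x \<bullet> z - y \<bullet> z"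
  using bracket_add_left[of "x - y" y z] by simp

lemma bracket_minus_right: "\<lbrakk>x \<in> V; y \<in> V\<rbrakk> \<Longrightarrow> x \<bullet> (- y) = - (x \<bullet> y)"
  using bracket_diff_right[of x 0 y] by simp

lemma bracket_minus_left: "\<lbrakk>x \<in> V; y \<in> V\<rbrakk> \<Longrightarrow> (- x) \<bullet> y = - (x \<bullet> y)"
  using bracket_diff_left[of 0 x y] by simp

lemma jacobi_derivation: "\<lbrakk>x \<in> V; y \<in> V; z \<in> V\<rbrakk> \<Longrightarrow> x \<bullet> (y \<bullet> z) = (x \<bullet> y) \<bullet> z + y \<bullet> (x \<bullet> z)"
  using jacobi[of x y z] bracket_anticommute[of z x] bracket_anticommute[of z "x \<bullet> y"]
  by (simp add: bracket_minus_right algebra_simps)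

lemma bracket_commutator: "\<lbrakk>x \<in> V; y \<in> V; z \<in> V\<rbrakk> \<Longrightarrow> (x \<bullet> y) \<bullet> z = x \<bullet> (y \<bullet> z) - y \<bullet> (x \<bullet> z)"
  using jacobi_derivation[of x y z] by (simp add: algebra_simps)

text \<open>
  Pairing the difference of \<open>D w\<close> and \<open>ad w - (ad w)\<^sup>*\<close> with a third vector gives a form as in the
  preceding lemma, because the torsion of \<open>ad w - (ad w)\<^sup>*\<close> is skew, too.
\<close>

lemma bismut_connection_is_ad_minus_adjoint:
  assumes D: "bismut_connection L h D" and "w \<in> V" "x \<in> V" "y \<in> V"
  shows "h (w \<bullet> x) y = h x (w \<bullet> y - D w y)"
proof -
  have DV: "D u v \<in> V" if "u \<in> V" "v \<in> V" for u v
    using that D unfolding bismut_connection_def linear_connection_def by blast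
  define a where "a u v w = Re (h (D u v) w) - Re (h (u \<bullet> v) w) + Re (h (u \<bullet> w) v)" for u v w
  have J_left: "Re (h (cstruct u) v) = - Re (h u (cstruct v))" if "u \<in> V" "v \<in> V" for u v
    using that by (simp add: cstruct_def scale_left scale_right)
  have sym: "Re (h u v) = Re (h v u)" if "u \<in> V" "v \<in> V" for u v
    using hermitian[OF that] by simp
  have D_skew: "Re (h (D u v) w) = - Re (h (D u w) v)" if "u \<in> V" "v \<in> V" "w \<in> V" for u v w
  proof -
    have "riem h (D u v) w + riem h v (D u w) = 0"
      using D that unfolding bismut_connection_def metric_parallel_def by blast
    then show ?thesis using sym[of v "D u w"] DV that by (simp add: riem_def)
  qed
  have D_J: "D u (cstruct v) = cstruct (D u v)" if "u \<in> V" "v \<in> V" for u v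
    using D that unfolding bismut_connection_def cstruct_parallel_def by blast
  have bracket_J: "u \<bullet> cstruct v = cstruct (u \<bullet> v)" if "u \<in> V" "v \<in> V" for u v
    using that by (simp add: cstruct_def bracket_scale_right)
  have torsion_skew: "Re (h (D v u) w) + Re (h (D w u) v)
      = - Re (h (u \<bullet> v) w) - Re (h (u \<bullet> w) v)" if "u \<in> V" "v \<in> V" "w \<in> V" for u v w
  proof -
    have "riem h (torsion L D u w) v = - riem h (torsion L D u v) w"
      using D that unfolding bismut_connection_def torsion_skew_def by blast
    then show ?thesis
      using D_skew[of u v w] DV that by (simp add: riem_def torsion_def diff_left)
  qed
  have skew_13: "a u v w = - a w v u" if "u \<in> V" "v \<in> V" "w \<in> V" for u v w
    using torsion_skew[of v u w] bracket_anticommute[of u v] bracket_anticommute[of w v]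
      bracket_anticommute[of u w] that by (simp add: a_def minus_left)
  have J: "a u (cstruct v) w = - a u v (cstruct w)" if "u \<in> V" "v \<in> V" "w \<in> V" for u v w
    using that DV bracket_closed J_left[of "u \<bullet> w" v]
    by (simp add: a_def D_J bracket_J J_left)
  have a0: "a u v w = 0" if "u \<in> V" "v \<in> V" "w \<in> V" for u v w
  proof (rule skew_form_compatible_with_J_vanishes[where a = a, OF subspace _ skew_13 J that])
    show "a u v w = - a u w v" if "u \<in> V" "v \<in> V" "w \<in> V" for u v w
      using D_skew[OF that] by (simp add: a_def)
  qed
  have real_part: "Re (h (w \<bullet> x) y) = Re (h x (w \<bullet> y - D w y))" if "w \<in> V" "x \<in> V" "y \<in> V" for w x y
    using a0[of w y x] that DV sym[of "w \<bullet> y" x] sym[of "D w y" x]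
    by (simp add: a_def diff_right)
  show ?thesis
    using real_part[of w x y] real_part[of w "\<i> *\<^sub>C x" y] assms(2-) DV
    by (simp add: complex_eq_iff bracket_scale_right scale_left)
qed

end

text \<open>
  \<open>E w\<close> stands for the adjoint \<open>(ad w)\<^sup>*\<close>. That it is a derivation is all that the classification
  uses of the BTP condition.
\<close>

locale hermitian_lie_algebra_adjoint_derivations = hermitian_lie_algebra +
  fixes E :: "'a \<Rightarrow> 'a \<Rightarrow> 'a"
  assumes E_in [simp, intro]: "\<lbrakk>w \<in> V; x \<in> V\<rbrakk> \<Longrightarrow> E w x \<in> V"
    and adjoint: "\<lbrakk>w \<in> V; x \<in> V; y \<in> V\<rbrakk> \<Longrightarrow> h (w \<bullet> x) y = h x (E w y)"
    and derivation: "\<lbrakk>w \<in> V; x \<in> V; y \<in> V\<rbrakk> \<Longrightarrow> E w (x \<bullet> y) = E w x \<bullet> y + x \<bullet> E w y"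

text \<open>
  The torsion is \<open>T(x, y) = [x, y] - (ad x)\<^sup>* y + (ad y)\<^sup>* x\<close>, whose summands are of
  different complex type: \<open>T(x, y) - T(\<i>x, \<i>y) = 2[x, y]\<close>. As \<open>D w\<close> is complex linear, it respects
  the types, so a parallel torsion forces \<open>D w\<close>, and hence \<open>(ad w)\<^sup>* = ad w - D w\<close>, to be a
  derivation of the bracket.
\<close>

lemma (in hermitian_lie_algebra) BTP_adjoint_derivations:
  assumes "BTP L h"
  obtains E where "hermitian_lie_algebra_adjoint_derivations L h E"
proof -
  obtain D where D: "bismut_connection L h D" and par: "torsion_parallel L D"
    using assms unfolding BTP_def by blast
  define E where "E w y = w \<bullet> y - D w y" for w y
  have DV [simp]: "D u v \<in> V" if "u \<in> V" "v \<in> V" for u v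
    using that D unfolding bismut_connection_def linear_connection_def by blast
  have EV [simp]: "E u v \<in> V" if "u \<in> V" "v \<in> V" for u v
    using that by (simp add: E_def)
  have adj: "h (w \<bullet> x) y = h x (E w y)" if "w \<in> V" "x \<in> V" "y \<in> V" for w x y
    using bismut_connection_is_ad_minus_adjoint[OF D that] by (simp add: E_def)
  have E_i: "E (\<i> *\<^sub>C w) y = - \<i> *\<^sub>C E w y" if "w \<in> V" "y \<in> V" for w y
    using that by (intro eqI_right)
      (auto simp: adj[symmetric] scale_right scale_left bracket_scale_left minus_right)
  have D_i: "D w (\<i> *\<^sub>C y) = \<i> *\<^sub>C D w y" if "w \<in> V" "y \<in> V" for w y
    using D that unfolding bismut_connection_def cstruct_parallel_def cstruct_def by blast
  have D_add: "D w (x + y) = D w x + D w y" if "w \<in> V" "x \<in> V" "y \<in> V" for w x y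
    using D that unfolding bismut_connection_def linear_connection_def by blast
  have E_i2: "E w (\<i> *\<^sub>C y) = \<i> *\<^sub>C E w y" if "w \<in> V" "y \<in> V" for w y
    using that
    by (simp add: E_def D_i bracket_scale_right complex_vector.scale_right_diff_distrib)
  have T: "torsion L D x y = x \<bullet> y - E x y + E y x" if "x \<in> V" "y \<in> V" for x y
    using bracket_anticommute[of y x] that by (simp add: torsion_def E_def)
  have T_i: "torsion L D x y = torsion L D (\<i> *\<^sub>C x) (\<i> *\<^sub>C y) + (x \<bullet> y + x \<bullet> y)"
    if "x \<in> V" "y \<in> V" for x y
    using that by (simp add: T E_i E_i2 bracket_scale_left bracket_scale_right scaleC_scaleC)
  have TV [simp]: "torsion L D x y \<in> V" if "x \<in> V" "y \<in> V" for x y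
    using that by (simp add: T)
  have parallel: "D w (torsion L D x y) = torsion L D (D w x) y + torsion L D x (D w y)"
    if "w \<in> V" "x \<in> V" "y \<in> V" for w x y
    using par that unfolding torsion_parallel_def by (simp add: algebra_simps)
  have two: "(2::complex) *\<^sub>C u = u + u" for u :: 'a
    using scaleC_add_left[of 1 1 u] by (simp add: scaleC_one)
  have D_derivation: "D w (x \<bullet> y) = D w x \<bullet> y + x \<bullet> D w y" if "w \<in> V" "x \<in> V" "y \<in> V" for w x y
  proof -
    have "D w (torsion L D x y)
        = D w (torsion L D (\<i> *\<^sub>C x) (\<i> *\<^sub>C y)) + (D w (x \<bullet> y) + D w (x \<bullet> y))"
      using that by (subst T_i) (auto simp: D_add)
    also have "D w (torsion L D (\<i> *\<^sub>C x) (\<i> *\<^sub>C y))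
        = torsion L D (\<i> *\<^sub>C D w x) (\<i> *\<^sub>C y) + torsion L D (\<i> *\<^sub>C x) (\<i> *\<^sub>C D w y)"
      using that by (simp add: parallel D_i)
    finally have "D w (x \<bullet> y) + D w (x \<bullet> y)
        = (D w x \<bullet> y + x \<bullet> D w y) + (D w x \<bullet> y + x \<bullet> D w y)"
      using parallel[OF that] T_i[of "D w x" y] T_i[of x "D w y"] that by (simp add: algebra_simps)
    then have "(2::complex) *\<^sub>C D w (x \<bullet> y) = (2::complex) *\<^sub>C (D w x \<bullet> y + x \<bullet> D w y)"
      by (simp only: two)
    then show ?thesis by simp
  qed
  have "hermitian_lie_algebra_adjoint_derivations L h E"
  proof
    show "E w (x \<bullet> y) = E w x \<bullet> y + x \<bullet> E w y" if "w \<in> V" "x \<in> V" "y \<in> V" for w x y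
      using that jacobi_derivation[of w x y]
      by (simp add: E_def D_derivation bracket_diff_left bracket_diff_right algebra_simps)
  qed (auto simp: adj)
  then show thesis by (rule that)
qed

context hermitian_lie_algebra_adjoint_derivations
begin

lemma E_bracket: "\<lbrakk>x \<in> V; y \<in> V; u \<in> V\<rbrakk> \<Longrightarrow> E (x \<bullet> y) u = E y (E x u) - E x (E y u)"
  by (intro eqI_right) (auto simp: adjoint[symmetric] diff_right diff_left bracket_commutator)

lemma E_zero: "\<lbrakk>w \<in> V\<rbrakk> \<Longrightarrow> E w 0 = 0"
  by (intro eqI_right) (auto simp: adjoint[symmetric] zero_right)

lemma E_add_index: "\<lbrakk>x \<in> V; y \<in> V; u \<in> V\<rbrakk> \<Longrightarrow> E (x + y) u = E x u + E y u"
  by (intro eqI_right) (auto simp: adjoint[symmetric] add_left add_right bracket_add_left)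

lemma E_scale_index: "\<lbrakk>x \<in> V; u \<in> V\<rbrakk> \<Longrightarrow> E (a *\<^sub>C x) u = cnj a *\<^sub>C E x u"
  by (intro eqI_right)
    (auto simp: adjoint[symmetric] scale_left scale_right bracket_scale_left)

text \<open>For \<open>n\<close> in a subspace that commutes with \<open>m\<close> and is stable under the adjoint of \<open>ad m\<close>, the vector
  \<open>(ad m)\<^sup>* n\<close> has square norm \<open>h [m, (ad m)\<^sup>* n] n = 0\<close>; so \<open>n\<close> is orthogonal to the image of \<open>ad m\<close>.\<close>

lemma orthogonal_if_adjoint_commutes:
  assumes "m \<in> V" "x \<in> V" "n \<in> V" "m \<bullet> E m n = 0"
  shows "h (m \<bullet> x) n = 0"
proof -
  have "h (E m n) (E m n) = h (m \<bullet> E m n) n"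
    using assms by (intro adjoint[symmetric]) auto
  then have "E m n = 0" using assms by (auto intro: self_zeroD simp: zero_left)
  then show ?thesis using assms by (simp add: adjoint zero_right)
qed

text \<open>The derivation \<open>(ad m)\<^sup>*\<close> maps \<open>[n1, n2]\<close> to \<open>[E m n1, n2] + [n1, E m n2]\<close>, which lies in the
  ideal \<open>N\<close> and so commutes with \<open>m\<close>.\<close>

lemma commuting_ideals_orthogonal:
  assumes N: "lie_ideal L N" and M: "M \<subseteq> V" "\<And>m n. m \<in> M \<Longrightarrow> n \<in> N \<Longrightarrow> m \<bullet> n = 0"
    and m: "m \<in> M" and x: "x \<in> V" and n: "n1 \<in> N" "n2 \<in> N"
  shows "h (m \<bullet> x) (n1 \<bullet> n2) = 0"
proof (rule orthogonal_if_adjoint_commutes)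
  have N': "N \<subseteq> V" "csubspace N" "\<And>x y. x \<in> V \<Longrightarrow> y \<in> N \<Longrightarrow> x \<bullet> y \<in> N"
    using N by (auto simp: lie_ideal_def)
  have mV: "m \<in> V" and nV: "n1 \<in> V" "n2 \<in> V" using m M n N' by auto
  show "m \<in> V" "x \<in> V" "n1 \<bullet> n2 \<in> V" using mV nV x by auto
  have "n1 \<bullet> E m n2 = - (E m n2 \<bullet> n1)" using bracket_anticommute mV nV by blast
  then have "n1 \<bullet> E m n2 \<in> N"
    using N' n mV nV by (simp add: complex_vector.subspace_neg)
  moreover have "E m n1 \<bullet> n2 \<in> N" using N' n mV nV by simp
  ultimately have "E m (n1 \<bullet> n2) \<in> N"
    using mV nV N'(2) by (simp add: derivation complex_vector.subspace_add)
  then show "m \<bullet> E m (n1 \<bullet> n2) = 0" using M(2) m by blast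
qed

lemma centre_orthogonal_brackets:
  assumes z: "z \<in> V" "\<And>x. x \<in> V \<Longrightarrow> z \<bullet> x = 0" and mx: "m \<in> V" "x \<in> V"
  shows "h (m \<bullet> x) z = 0"
proof (rule orthogonal_if_adjoint_commutes)
  have "E m (z \<bullet> m) = E m z \<bullet> m + z \<bullet> E m m" using z mx derivation by blast
  then have "E m z \<bullet> m = 0" using z mx by (simp add: E_zero)
  then show "m \<bullet> E m z = 0" using bracket_anticommute[of m "E m z"] z mx by simp
qed (use z mx in auto)

end

section \<open>Metrics on a simple Lie algebra\<close>

lemma simple_centreless:
  assumes simple: "simple_complex_lie_algebra L"
    and z: "z \<in> lie_carrier L" "\<And>x. x \<in> lie_carrier L \<Longrightarrow> lie_bracket L z x = 0"
  shows "z = 0"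
proof -
  interpret complex_lie_algebra L using simple by (simp add: simple_complex_lie_algebra_def)
  let ?V = "lie_carrier L"
  define Z where "Z = {z \<in> ?V. \<forall>x\<in>?V. lie_bracket L x z = 0}"
  have zero: "lie_bracket L x 0 = 0" if "x \<in> ?V" for x
    using bracket_add_right[of x 0 0] that complex_vector.subspace_0[OF subspace_carrier] by simp
  have "lie_ideal L Z"
    unfolding lie_ideal_def complex_vector.subspace_def
    using complex_vector.subspace_0[OF subspace_carrier]
      complex_vector.subspace_add[OF subspace_carrier] complex_vector.subspace_scale[OF subspace_carrier]
    by (auto simp: Z_def zero bracket_add_right bracket_scale_right)
  then have "Z = {0} \<or> Z = ?V" using simple by (simp add: simple_complex_lie_algebra_def)
  moreover have "Z \<noteq> ?V" using simple by (auto simp: simple_complex_lie_algebra_def Z_def)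
  moreover have "z \<in> Z" using z bracket_anticommute[of _ z] by (auto simp: Z_def)
  ultimately show ?thesis by blast
qed

lemma simple_spanned_by_brackets:
  assumes simple: "simple_complex_lie_algebra L" and S: "csubspace S"
    and br: "\<And>x y. \<lbrakk>x \<in> lie_carrier L; y \<in> lie_carrier L\<rbrakk> \<Longrightarrow> lie_bracket L x y \<in> S"
  shows "lie_carrier L \<subseteq> S"
proof -
  interpret complex_lie_algebra L using simple by (simp add: simple_complex_lie_algebra_def)
  let ?V = "lie_carrier L"
  define N where "N = cspan {lie_bracket L x y | x y. x \<in> ?V \<and> y \<in> ?V}"
  have "N \<subseteq> ?V"
    unfolding N_def by (rule complex_vector.span_minimal) (auto simp: subspace_carrier bracket_closed)
  then have "lie_ideal L N"
    unfolding lie_ideal_def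
    by (auto simp: N_def intro!: complex_vector.span_base intro: complex_vector.subspace_span)
  then have "N = {0} \<or> N = ?V" using simple by (simp add: simple_complex_lie_algebra_def)
  moreover have "N \<noteq> {0}"
    using simple complex_vector.span_base[of _ "{lie_bracket L x y | x y. x \<in> ?V \<and> y \<in> ?V}"]
    unfolding simple_complex_lie_algebra_def N_def by blast
  moreover have "N \<subseteq> S"
    unfolding N_def using S br by (intro complex_vector.span_minimal) auto
  ultimately show ?thesis by blast
qed

text \<open>
  The \<open>x\<close> for which \<open>(ad x)\<^sup>*\<close> is inner form an ideal. It contains all \<open>(ad y)\<^sup>* x\<close>, since
  \<open>ad ((ad y)\<^sup>* x) = [(ad y)\<^sup>*, ad x]\<close> has the adjoint \<open>[(ad x)\<^sup>*, ad y] = ad ((ad x)\<^sup>* y)\<close>; were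
  the ideal zero, all \<open>(ad y)\<^sup>*\<close> and hence all \<open>ad y\<close> would vanish. Positivity of the metric thus
  takes the place of Cartan's criterion, by which all derivations of \<open>L\<close> would be inner.
\<close>

lemma (in hermitian_lie_algebra_adjoint_derivations) simple_adjoint_inner:
  assumes simple: "simple_complex_lie_algebra L" and "x \<in> V"
  shows "\<exists>z\<in>V. \<forall>u\<in>V. E x u = z \<bullet> u"
proof -
  define I where "I = {x \<in> V. \<exists>z\<in>V. \<forall>u\<in>V. E x u = z \<bullet> u}"
  have E_E: "E (E y x) u = E x y \<bullet> u" if "x \<in> V" "y \<in> V" "u \<in> V" for x y u
  proof (rule eqI_right)
    fix v assume v: "v \<in> V"
    have E_adj: "h (E y a) b = h a (y \<bullet> b)" if "a \<in> V" "b \<in> V" "y \<in> V" for a b y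
      using adjoint[of y b a] hermitian[of "y \<bullet> b" a] hermitian[of b "E y a"] that by simp
    have "h v (E (E y x) u) = h (E y x \<bullet> v) u" using v that by (simp add: adjoint)
    also have "E y x \<bullet> v = E y (x \<bullet> v) - x \<bullet> E y v" using v that by (simp add: derivation)
    also have "h \<dots> u = h v (E x (y \<bullet> u)) - h v (y \<bullet> E x u)"
      using v that by (simp add: diff_left E_adj adjoint)
    also have "\<dots> = h v (E x y \<bullet> u)"
      using v that by (simp add: diff_right[symmetric] derivation)
    finally show "h v (E (E y x) u) = h v (E x y \<bullet> u)" .
  qed (use that in auto)
  have "lie_ideal L I"
    unfolding lie_ideal_def complex_vector.subspace_def
  proof (intro conjI ballI allI)
    have "E 0 u = 0 \<bullet> u" if "u \<in> V" for u
      using E_scale_index[of 0 u 0] that by simp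
    then show "0 \<in> I" unfolding I_def by blast
    show "I \<subseteq> V" by (auto simp: I_def)
  next
    fix x y assume "x \<in> I" "y \<in> I"
    then obtain z w where "x \<in> V" "y \<in> V" "z \<in> V" "w \<in> V"
      "\<And>u. u \<in> V \<Longrightarrow> E x u = z \<bullet> u" "\<And>u. u \<in> V \<Longrightarrow> E y u = w \<bullet> u"
      by (auto simp: I_def)
    then have "\<forall>u\<in>V. E (x + y) u = (z + w) \<bullet> u"
      by (simp add: E_add_index bracket_add_left)
    then show "x + y \<in> I"
      using \<open>x \<in> V\<close> \<open>y \<in> V\<close> \<open>z \<in> V\<close> \<open>w \<in> V\<close> by (auto simp: I_def)
  next
    fix c x assume "x \<in> I"
    then obtain z where "x \<in> V" "z \<in> V" "\<And>u. u \<in> V \<Longrightarrow> E x u = z \<bullet> u"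
      by (auto simp: I_def)
    then have "\<forall>u\<in>V. E (c *\<^sub>C x) u = (cnj c *\<^sub>C z) \<bullet> u"
      by (simp add: E_scale_index bracket_scale_left)
    then show "c *\<^sub>C x \<in> I" using \<open>x \<in> V\<close> \<open>z \<in> V\<close> scale_in unfolding I_def by blast
  next
    fix y x assume y: "y \<in> V" and "x \<in> I"
    then obtain z where z: "x \<in> V" "z \<in> V" "\<And>u. u \<in> V \<Longrightarrow> E x u = z \<bullet> u"
      by (auto simp: I_def)
    have "\<forall>u\<in>V. E (y \<bullet> x) u = (- E y z) \<bullet> u"
      using y z by (simp add: E_bracket derivation bracket_minus_left)
    then show "y \<bullet> x \<in> I" using y z minus_in[OF E_in[OF y z(2)]] unfolding I_def by blast
  qed
  then have "I = {0} \<or> I = V" using simple by (simp add: simple_complex_lie_algebra_def)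
  moreover have "I \<noteq> {0}"
  proof
    assume "I = {0}"
    moreover have "E y x \<in> I" if "x \<in> V" "y \<in> V" for x y
      using that E_E[of x y] unfolding I_def by blast
    ultimately have E0: "E y x = 0" if "x \<in> V" "y \<in> V" for x y using that by blast
    have "y \<bullet> x = 0" if "x \<in> V" "y \<in> V" for x y
      using that by (intro eqI_left) (auto simp: adjoint E0 zero_left zero_right)
    then show False using simple by (auto simp: simple_complex_lie_algebra_def)
  qed
  ultimately show ?thesis using \<open>x \<in> V\<close> by (auto simp: I_def)
qed

text \<open>Here \<open>(ad x)\<^sup>* = ad (\<sigma> x)\<close>. The map \<open>- \<sigma>\<close> is the Cartan involution of the compact real
  form that consists of the \<open>x\<close> with skew-Hermitian \<open>ad x\<close>.\<close>

locale simple_lie_algebra_involution = hermitian_lie_algebra +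
  fixes \<sigma> :: "'a \<Rightarrow> 'a"
  assumes simple: "simple_complex_lie_algebra L"
    and \<sigma>_in [simp, intro]: "x \<in> V \<Longrightarrow> \<sigma> x \<in> V"
    and \<sigma>_adjoint: "\<lbrakk>x \<in> V; u \<in> V; y \<in> V\<rbrakk> \<Longrightarrow> h (x \<bullet> u) y = h u (\<sigma> x \<bullet> y)"
begin

lemma ad_eqI:
  assumes "x \<in> V" "y \<in> V" "\<And>u. u \<in> V \<Longrightarrow> x \<bullet> u = y \<bullet> u"
  shows "x = y"
  using simple_centreless[OF simple, of "x - y"] assms by (simp add: bracket_diff_left)

lemma \<sigma>_eqI:
  assumes "x \<in> V" "z \<in> V" "\<And>u v. u \<in> V \<Longrightarrow> v \<in> V \<Longrightarrow> h (x \<bullet> v) u = h v (z \<bullet> u)"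
  shows "\<sigma> x = z"
proof (rule ad_eqI)
  fix u assume "u \<in> V"
  then show "\<sigma> x \<bullet> u = z \<bullet> u"
    using assms by (intro eqI_right) (auto simp: \<sigma>_adjoint[symmetric])
qed (use assms in auto)

lemma \<sigma>_add: "\<lbrakk>x \<in> V; y \<in> V\<rbrakk> \<Longrightarrow> \<sigma> (x + y) = \<sigma> x + \<sigma> y"
  by (intro \<sigma>_eqI) (auto simp: \<sigma>_adjoint bracket_add_left add_left add_right)

lemma \<sigma>_scale: "x \<in> V \<Longrightarrow> \<sigma> (a *\<^sub>C x) = cnj a *\<^sub>C \<sigma> x"
  by (intro \<sigma>_eqI) (auto simp: \<sigma>_adjoint bracket_scale_left scale_left scale_right)

lemma \<sigma>_bracket: "\<lbrakk>x \<in> V; y \<in> V\<rbrakk> \<Longrightarrow> \<sigma> (x \<bullet> y) = \<sigma> y \<bullet> \<sigma> x"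
  by (intro \<sigma>_eqI) (auto simp: bracket_commutator diff_left diff_right \<sigma>_adjoint)

lemma \<sigma>_\<sigma> [simp]:
  assumes "x \<in> V"
  shows "\<sigma> (\<sigma> x) = x"
proof (rule \<sigma>_eqI)
  fix u v assume "u \<in> V" "v \<in> V"
  then show "h (\<sigma> x \<bullet> v) u = h v (x \<bullet> u)"
    using \<sigma>_adjoint[of x u v] hermitian[of u "\<sigma> x \<bullet> v"] hermitian[of "x \<bullet> u" v] assms by simp
qed (use assms in auto)

end

lemma BTP_simple_involution:
  assumes simple: "simple_complex_lie_algebra L" and h: "hermitian_metric L h" and "BTP L h"
  obtains \<sigma> where "simple_lie_algebra_involution L h \<sigma>"
proof -
  interpret complex_lie_algebra L using simple by (simp add: simple_complex_lie_algebra_def)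
  interpret hermitian_lie_algebra L h by unfold_locales (fact h)
  obtain E where "hermitian_lie_algebra_adjoint_derivations L h E"
    using BTP_adjoint_derivations \<open>BTP L h\<close> by blast
  then interpret hermitian_lie_algebra_adjoint_derivations L h E .
  obtain \<sigma> where \<sigma>: "\<And>x. x \<in> V \<Longrightarrow> \<sigma> x \<in> V" "\<And>x u. x \<in> V \<Longrightarrow> u \<in> V \<Longrightarrow> E x u = \<sigma> x \<bullet> u"
    using simple_adjoint_inner[OF simple] by metis
  have "simple_lie_algebra_involution L h \<sigma>"
    by unfold_locales (auto simp: simple \<sigma> adjoint)
  then show thesis by (rule that)
qed

lemma (in complex_lie_algebra) automorphism_B_isometry:
  assumes f: "\<And>x. x \<in> lie_carrier L \<Longrightarrow> f x \<in> lie_carrier L"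
      "\<And>x y. \<lbrakk>x \<in> lie_carrier L; y \<in> lie_carrier L\<rbrakk> \<Longrightarrow> f (x + y) = f x + f y"
      "\<And>a x. x \<in> lie_carrier L \<Longrightarrow> f (a *\<^sub>C x) = a *\<^sub>C f x"
    and g: "\<And>x. x \<in> lie_carrier L \<Longrightarrow> g x \<in> lie_carrier L"
      "\<And>x y. \<lbrakk>x \<in> lie_carrier L; y \<in> lie_carrier L\<rbrakk> \<Longrightarrow> g (x + y) = g x + g y"
      "\<And>a x. x \<in> lie_carrier L \<Longrightarrow> g (a *\<^sub>C x) = a *\<^sub>C g x"
    and inverse: "\<And>x. x \<in> lie_carrier L \<Longrightarrow> f (g x) = x" "\<And>x. x \<in> lie_carrier L \<Longrightarrow> g (f x) = x"
    and bracket: "\<And>x y. \<lbrakk>x \<in> lie_carrier L; y \<in> lie_carrier L\<rbrakk>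
      \<Longrightarrow> f (lie_bracket L x y) = lie_bracket L (f x) (f y)"
  shows "B_isometry L f"
  unfolding B_isometry_def
proof (intro conjI ballI allI)
  show "bij_betw f (lie_carrier L) (lie_carrier L)"
    using f(1) g(1) inverse by (intro bij_betw_byWitness[of _ g]) auto
  fix x y assume x: "x \<in> lie_carrier L" and y: "y \<in> lie_carrier L"
  show "killing_form L (f x) (f y) = killing_form L x y"
    unfolding killing_form_def
    by (rule lie_trace_commute[where F = f and G = "\<lambda>z. lie_bracket L x (lie_bracket L y (g z))"])
      (simp_all add: x y f g inverse bracket bracket_closed bracket_add_right bracket_scale_right)
qed (auto simp: f)

text \<open>
  With involutions \<open>\<sigma>\<close> of \<open>g\<close> and \<open>\<tau>\<close> of \<open>h\<close>, the map \<open>f = \<sigma> \<circ> \<tau>\<close> is a complex linear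
  automorphism, and the adjoint of \<open>ad w\<close> for the form \<open>g (f x) y\<close> is \<open>ad (\<tau> w)\<close>, as for \<open>h\<close>. By
  Schur's lemma the two forms are proportional, \<open>h x y = c g (f x) y\<close>. To see that \<open>c\<close> is real,
  note that \<open>c p\<close> is real and nonzero for each eigenvalue \<open>p\<close> of \<open>f\<close>, by positivity of both metrics. If \<open>p\<close>, \<open>q\<close>
  are eigenvalues whose eigenvectors have a nonzero bracket, then \<open>p q\<close> is an eigenvalue, too, and
  \<open>c = (c p) (c q) / (c p q)\<close>.
\<close>

lemma simple_metrics_proportional_up_to_automorphism:
  assumes g: "simple_lie_algebra_involution L g \<sigma>" and h: "simple_lie_algebra_involution L h \<tau>"
  shows "\<exists>(c::real) f. B_isometry L f \<and>
    (\<forall>x\<in>lie_carrier L. \<forall>y\<in>lie_carrier L. h x y = complex_of_real c * g (f x) y)"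
proof -
  interpret g: simple_lie_algebra_involution L g \<sigma> by (fact g)
  interpret h: simple_lie_algebra_involution L h \<tau> by (fact h)
  let ?V = "lie_carrier L"
  let ?br = "lie_bracket L"
  define f where "f x = \<sigma> (\<tau> x)" for x
  define f' where "f' x = \<tau> (\<sigma> x)" for x
  have f_in [simp]: "f x \<in> ?V" and f'_in [simp]: "f' x \<in> ?V" if "x \<in> ?V" for x
    using that by (auto simp: f_def f'_def)
  have ff' [simp]: "f (f' x) = x" "f' (f x) = x" if "x \<in> ?V" for x
    using that by (auto simp: f_def f'_def)
  have f_add: "f (x + y) = f x + f y" and f'_add: "f' (x + y) = f' x + f' y"
    if "x \<in> ?V" "y \<in> ?V" for x y
    using that by (simp_all add: f_def f'_def g.\<sigma>_add h.\<sigma>_add)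
  have f_scale: "f (a *\<^sub>C x) = a *\<^sub>C f x" and f'_scale: "f' (a *\<^sub>C x) = a *\<^sub>C f' x"
    if "x \<in> ?V" for a x
    using that by (simp_all add: f_def f'_def g.\<sigma>_scale h.\<sigma>_scale)
  have f_bracket: "f (?br x y) = ?br (f x) (f y)" if "x \<in> ?V" "y \<in> ?V" for x y
    using that by (simp add: f_def g.\<sigma>_bracket h.\<sigma>_bracket)
  have f_zero: "f 0 = 0" using f_scale[of 0 0] by simp
  obtain b where b: "finite b" "?V \<subseteq> cspan b" using g.finite_dim by blast
  obtain x0 where x0: "x0 \<in> ?V" "x0 \<noteq> 0"
    using g.simple g.bracket_zero by (force simp: simple_complex_lie_algebra_def)
  obtain P where P: "\<And>x. x \<in> ?V \<Longrightarrow> P x \<in> ?V"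
    "\<And>x y. \<lbrakk>x \<in> ?V; y \<in> ?V\<rbrakk> \<Longrightarrow> P (x + y) = P x + P y"
    "\<And>a x. x \<in> ?V \<Longrightarrow> P (a *\<^sub>C x) = a *\<^sub>C P x"
    "\<And>x y. \<lbrakk>x \<in> ?V; y \<in> ?V\<rbrakk> \<Longrightarrow> g (P x) y = h x y"
    by (rule g.form_represented_by_operator[of h])
      (auto simp: h.add_left h.scale_left intro: h.hermitian)
  have P_zero: "P 0 = 0" using P(3)[of 0 0] by simp
  obtain c x1 where x1: "x1 \<in> ?V" "x1 \<noteq> 0" "P (f' x1) = c *\<^sub>C x1"
    by (rule invariant_subspace_eigenvector[OF g.subspace b x0, of "P \<circ> f'"])
      (auto simp: P f'_add f'_scale)
  \<comment> \<open>\<open>P \<circ> f\<^sup>-\<^sup>1\<close> commutes with all \<open>ad w\<close>, so its eigenspace for \<open>c\<close>, pulled back by \<open>f\<close>, is a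
    nonzero ideal.\<close>
  define I where "I = {x \<in> ?V. P x = c *\<^sub>C f x}"
  have "lie_ideal L I"
    unfolding lie_ideal_def complex_vector.subspace_def
  proof (intro conjI ballI allI)
    show "0 \<in> I" by (simp add: I_def P_zero f_zero)
    show "I \<subseteq> ?V" by (auto simp: I_def)
    show "x + y \<in> I" if "x \<in> I" "y \<in> I" for x y
      using that by (simp add: I_def P f_add complex_vector.scale_right_distrib)
    show "a *\<^sub>C x \<in> I" if "x \<in> I" for a x
      using that by (simp add: I_def P f_scale mult.commute)
    fix w x assume w: "w \<in> ?V" and "x \<in> I"
    then have x: "x \<in> ?V" "P x = c *\<^sub>C f x" by (auto simp: I_def)
    have "P (?br w x) = c *\<^sub>C f (?br w x)"
    proof (rule g.eqI_left)
      fix y assume y: "y \<in> ?V"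
      have "g (P (?br w x)) y = g (P x) (?br (\<tau> w) y)"
        using w x(1) y by (simp add: P h.\<sigma>_adjoint)
      also have "\<dots> = c * g (f x) (?br (\<sigma> (f w)) y)"
        using w x y by (simp add: f_def g.scale_left)
      also have "\<dots> = g (c *\<^sub>C f (?br w x)) y"
        using w x y by (simp add: g.scale_left f_bracket g.\<sigma>_adjoint)
      finally show "g (P (?br w x)) y = g (c *\<^sub>C f (?br w x)) y" .
    qed (use w x P in auto)
    then show "?br w x \<in> I" using w x by (simp add: I_def)
  qed
  then have "I = {0} \<or> I = ?V" using g.simple by (simp add: simple_complex_lie_algebra_def)
  moreover have "f' x1 \<in> I" using x1 by (simp add: I_def)
  moreover have "f' x1 \<noteq> 0" using x1 ff'(1)[of x1] f_zero by metis
  ultimately have "I = ?V" by blast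
  then have Pf: "P x = c *\<^sub>C f x" if "x \<in> ?V" for x
    using that unfolding I_def by blast
  have hg: "h x y = c * g (f x) y" if "x \<in> ?V" "y \<in> ?V" for x y
    using that P(4)[of x y] by (simp add: Pf g.scale_left)
  have eigenvalue: "c * p \<in> \<real>" "c * p \<noteq> 0" if "x \<in> ?V" "x \<noteq> 0" "f x = p *\<^sub>C x" for x p
  proof -
    have "h x x = (c * p) * g x x" using hg[of x x] that by (simp add: g.scale_left)
    moreover have "h x x \<noteq> 0" "g x x \<noteq> 0" using that h.self_zeroD g.self_zeroD by auto
    ultimately have "c * p = h x x / g x x" "h x x / g x x \<noteq> 0" by (auto simp: field_simps)
    moreover have "h x x \<in> \<real>" "g x x \<in> \<real>"
      using h.self_real[of x] g.self_real[of x] that by (metis Reals_of_real)+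
    ultimately show "c * p \<in> \<real>" "c * p \<noteq> 0" by (metis Reals_divide)+
  qed
  obtain p x where x: "x \<in> ?V" "x \<noteq> 0" "f x = p *\<^sub>C x"
    by (rule invariant_subspace_eigenvector[OF g.subspace b x0, of f]) (auto simp: f_add f_scale)
  \<comment> \<open>An eigenvector \<open>y\<close> that does not commute with \<open>x\<close> is found in the orthogonal complement of the
    centraliser of \<open>x\<close>, which is the image of \<open>ad (\<sigma> x)\<close>.\<close>
  define W where "W = (\<lambda>z. ?br (\<sigma> x) z) ` ?V"
  have "csubspace W"
    unfolding complex_vector.subspace_def W_def
  proof (intro conjI ballI allI)
    show "0 \<in> (\<lambda>z. ?br (\<sigma> x) z) ` ?V" using x by (intro image_eqI[of _ _ 0]) auto
  next
    fix u v assume "u \<in> (\<lambda>z. ?br (\<sigma> x) z) ` ?V" "v \<in> (\<lambda>z. ?br (\<sigma> x) z) ` ?V"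
    then obtain z w where "u = ?br (\<sigma> x) z" "v = ?br (\<sigma> x) w" "z \<in> ?V" "w \<in> ?V" by auto
    then show "u + v \<in> (\<lambda>z. ?br (\<sigma> x) z) ` ?V"
      using x by (intro image_eqI[of _ _ "z + w"]) (auto simp: g.bracket_add_right)
  next
    fix a v assume "v \<in> (\<lambda>z. ?br (\<sigma> x) z) ` ?V"
    then obtain w where "v = ?br (\<sigma> x) w" "w \<in> ?V" by auto
    then show "a *\<^sub>C v \<in> (\<lambda>z. ?br (\<sigma> x) z) ` ?V"
      using x by (intro image_eqI[of _ _ "a *\<^sub>C w"]) (auto simp: g.bracket_scale_right)
  qed
  have W_V: "W \<subseteq> ?V" using x by (auto simp: W_def)
  have "p \<noteq> 0" using eigenvalue(2)[OF x] by auto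
  have "f' x = (1 / p) *\<^sub>C x"
  proof -
    have "p *\<^sub>C f' x = f' (f x)" by (simp add: x f'_scale)
    then have "(1 / p) *\<^sub>C p *\<^sub>C f' x = (1 / p) *\<^sub>C x" using x(1) by simp
    then show ?thesis using \<open>p \<noteq> 0\<close> by (simp add: scaleC_scaleC)
  qed
  then have f_\<sigma>x: "f (\<sigma> x) = cnj (1 / p) *\<^sub>C \<sigma> x"
    using x(1) g.\<sigma>_scale[of x "1 / p"] by (simp add: f_def f'_def)
  have f_W: "f y \<in> W" if y: "y \<in> W" for y
  proof -
    obtain z where z: "z \<in> ?V" "y = ?br (\<sigma> x) z" using y by (auto simp: W_def)
    then have "f y = ?br (\<sigma> x) (cnj (1 / p) *\<^sub>C f z)"
      using x(1) by (simp add: f_bracket f_\<sigma>x g.bracket_scale_left g.bracket_scale_right)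
    then show ?thesis using z(1) unfolding W_def by (intro image_eqI[of _ _ "cnj (1 / p) *\<^sub>C f z"]) auto
  qed
  have "\<sigma> 0 = 0" using g.\<sigma>_scale[of 0 0] by simp
  then have "\<sigma> x \<noteq> 0" using x g.\<sigma>_\<sigma>[of x] by metis
  then obtain z where z: "z \<in> ?V" "?br (\<sigma> x) z \<noteq> 0"
    using simple_centreless[OF g.simple, of "\<sigma> x"] x by blast
  obtain q y where y: "y \<in> W" "y \<noteq> 0" "f y = q *\<^sub>C y"
    by (rule invariant_subspace_eigenvector[OF \<open>csubspace W\<close> b(1) _ _ z(2), of f])
      (use W_V b(2) z f_W in \<open>auto simp: f_add f_scale subset_iff W_def\<close>)
  then obtain z' where z': "z' \<in> ?V" "y = ?br (\<sigma> x) z'" by (auto simp: W_def)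
  have yV: "y \<in> ?V" using y W_V by auto
  have "g (?br x y) z' = g y y" using x(1) yV z' by (simp add: g.\<sigma>_adjoint)
  then have "?br x y \<noteq> 0" using g.self_zeroD[OF yV] y z' by (auto simp: g.zero_left)
  moreover have "f (?br x y) = (p * q) *\<^sub>C ?br x y"
    using x yV y
    by (simp add: f_bracket g.bracket_scale_left g.bracket_scale_right scaleC_scaleC mult.commute)
  ultimately have pq: "c * (p * q) \<in> \<real>" "c * (p * q) \<noteq> 0"
    using eigenvalue[of "?br x y" "p * q"] x(1) yV by auto
  have "c = (c * p) * (c * q) / (c * (p * q))" using pq(2) by (simp add: field_simps)
  also have "\<dots> \<in> \<real>"
    using Reals_divide[OF Reals_mult[OF eigenvalue(1)[OF x] eigenvalue(1)[OF yV y(2,3)]] pq(1)] .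
  finally obtain d where d: "c = complex_of_real d" by (auto elim: Reals_cases)
  have "B_isometry L f"
    by (rule g.automorphism_B_isometry[of f f']) (auto simp: f_add f_scale f'_add f'_scale f_bracket)
  then show ?thesis using hg d by blast
qed

section \<open>Products\<close>

lemma hermitian_metric_pullback:
  assumes h: "hermitian_metric L h"
    and \<phi>: "\<And>x. x \<in> lie_carrier K \<Longrightarrow> \<phi> x \<in> lie_carrier L"
      "\<And>x y. \<lbrakk>x \<in> lie_carrier K; y \<in> lie_carrier K\<rbrakk> \<Longrightarrow> \<phi> (x + y) = \<phi> x + \<phi> y"
      "\<And>a x. x \<in> lie_carrier K \<Longrightarrow> \<phi> (a *\<^sub>C x) = a *\<^sub>C \<phi> x"
      "\<And>x. x \<in> lie_carrier K \<Longrightarrow> \<phi> x = 0 \<Longrightarrow> x = 0"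
  shows "hermitian_metric K (\<lambda>x y. h (\<phi> x) (\<phi> y))"
proof -
  have add: "h (x + y) z = h x z + h y z" and scale: "h (a *\<^sub>C x) y = a * h x y"
    and sym: "h y x = cnj (h x y)" and pos: "x \<noteq> 0 \<longrightarrow> Re (h x x) > 0"
    if "x \<in> lie_carrier L" "y \<in> lie_carrier L" "z \<in> lie_carrier L" for a x y z
    using h that unfolding hermitian_metric_def by blast+
  show ?thesis
    unfolding hermitian_metric_def
  proof (intro conjI ballI allI)
    fix x assume x: "x \<in> lie_carrier K"
    show "x \<noteq> 0 \<longrightarrow> Re (h (\<phi> x) (\<phi> x)) > 0" using \<phi>(1,4)[OF x] pos by blast
    fix y assume y: "y \<in> lie_carrier K"
    show "h (\<phi> y) (\<phi> x) = cnj (h (\<phi> x) (\<phi> y))"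
      using \<phi>(1)[OF x] \<phi>(1)[OF y] by (intro sym) auto
    show "h (\<phi> (a *\<^sub>C x)) (\<phi> y) = a * h (\<phi> x) (\<phi> y)" for a
      unfolding \<phi>(3)[OF x] using \<phi>(1)[OF x] \<phi>(1)[OF y] by (intro scale) auto
    fix z assume z: "z \<in> lie_carrier K"
    show "h (\<phi> (x + y)) (\<phi> z) = h (\<phi> x) (\<phi> z) + h (\<phi> y) (\<phi> z)"
      unfolding \<phi>(2)[OF x y] using \<phi>(1)[OF x] \<phi>(1)[OF y] \<phi>(1)[OF z] by (intro add) auto
  qed
qed

lemma euclidean_metric_kaehler_flat:
  assumes h: "hermitian_metric (euclidean_lie k) h"
  shows "kaehler (euclidean_lie k) h" "flat (euclidean_lie k) h"
proof -
  let ?V = "lie_carrier (euclidean_lie k)"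
  have zero: "0 \<in> ?V" by (simp add: euclidean_lie_def)
  have h0: "h 0 y = 0" "h y 0 = 0" if "y \<in> ?V" for y
  proof -
    have "h (0 *\<^sub>C 0) y = 0 * h 0 y" using h zero that unfolding hermitian_metric_def by blast
    then show "h 0 y = 0" by simp
    moreover have "h y 0 = cnj (h 0 y)" using h zero that unfolding hermitian_metric_def by blast
    ultimately show "h y 0 = 0" by simp
  qed
  have br: "lie_bracket (euclidean_lie k) = (\<lambda>x y. 0)"
    by (simp add: euclidean_lie_def zero_fun_def)
  show "kaehler (euclidean_lie k) h"
    by (simp add: kaehler_def br fundamental_form_def riem_def cstruct_def h0)
  show "flat (euclidean_lie k) h"
    unfolding flat_def
    by (intro exI[of _ "\<lambda>x y. 0"])
      (simp add: levi_civita_connection_def linear_connection_def metric_parallel_def torsion_def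
        curvature_def br riem_def h0 zero)
qed

text \<open>
  Simple factors are spanned by their brackets, so their orthogonality to each other and to the
  centre need only be tested on brackets, where \<open>commuting_ideals_orthogonal\<close> and
  \<open>centre_orthogonal_brackets\<close> apply.
\<close>

lemma BTP_metric_on_product:
  fixes L :: "nat \<Rightarrow> 'a::complex_vector lie"
  assumes simple: "\<And>i. i < r \<Longrightarrow> simple_complex_lie_algebra (L i)"
    and h: "hermitian_metric (product_lie k r L) h" and BTP: "BTP (product_lie k r L) h"
  shows "\<exists>h0 hs. hermitian_metric (euclidean_lie k) h0 \<and>
    (\<forall>i<r. hermitian_metric (L i) (hs i)) \<and>
    (\<forall>(x, u)\<in>lie_carrier (product_lie k r L). \<forall>(y, v)\<in>lie_carrier (product_lie k r L).
      h (x, u) (y, v) = h0 x y + (\<Sum>i<r. hs i (u i) (v i)))"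
proof -
  let ?P = "product_lie k r L"
  let ?V = "lie_carrier ?P" and ?br = "lie_bracket ?P"
  have L: "complex_lie_algebra (L i)" if "i < r" for i
    using simple[OF that] by (simp add: simple_complex_lie_algebra_def)
  interpret complex_lie_algebra ?P using L by (rule product_lie_complex_lie_algebra)
  interpret hermitian_lie_algebra ?P h by unfold_locales (fact h)
  obtain E where "hermitian_lie_algebra_adjoint_derivations ?P h E"
    using BTP_adjoint_derivations[OF BTP] by blast
  then interpret hermitian_lie_algebra_adjoint_derivations ?P h E .
  have mem: "p \<in> ?V \<longleftrightarrow>
      (\<forall>j\<ge>k. fst p j = 0) \<and> (\<forall>i<r. snd p i \<in> lie_carrier (L i)) \<and> (\<forall>i\<ge>r. snd p i = 0)" for p
    by (cases p) (auto simp: product_lie_def euclidean_lie_def)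
  have br: "?br p q = (0, \<lambda>i. if i < r then lie_bracket (L i) (snd p i) (snd q i) else 0)" for p q
    by (cases p; cases q) (auto simp: product_lie_def euclidean_lie_def zero_fun_def)
  have L_0: "0 \<in> lie_carrier (L i)" if "i < r" for i
    using complex_vector.subspace_0[OF complex_lie_algebra.subspace_carrier[OF L[OF that]]] .
  have L_br_0: "lie_bracket (L i) x 0 = 0" "lie_bracket (L i) 0 x = 0"
    if "i < r" "x \<in> lie_carrier (L i)" for i x
    using complex_lie_algebra.bracket_add_right[OF L, of i x 0 0]
      complex_lie_algebra.bracket_add_left[OF L, of i 0 0 x] that L_0 by auto
  define \<kappa> where "\<kappa> x = (x, 0 :: nat \<Rightarrow> 'a)" for x :: "nat \<Rightarrow> complex"
  define \<iota> where "\<iota> i a = (0 :: nat \<Rightarrow> complex, \<lambda>m. if m = i then a else 0 :: 'a)" for i :: nat and a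
  have \<kappa>_in: "\<kappa> x \<in> ?V" if "x \<in> lie_carrier (euclidean_lie k)" for x
    using that L_0 by (auto simp: mem \<kappa>_def euclidean_lie_def)
  have \<iota>_in: "\<iota> i a \<in> ?V" if "i < r" "a \<in> lie_carrier (L i)" for i a
    using that L_0 by (auto simp: mem \<iota>_def)
  have \<iota>_add: "\<iota> i (a + b) = \<iota> i a + \<iota> i b" for i a b
    by (auto simp: \<iota>_def prod_eq_iff fun_eq_iff)
  have \<iota>_scale: "\<iota> i (c *\<^sub>C a) = c *\<^sub>C \<iota> i a" for i a c
    by (auto simp: \<iota>_def prod_eq_iff fun_eq_iff scaleC_prod_def scaleC_fun_def)
  have \<iota>_zero: "\<iota> i 0 = 0" for i
    by (auto simp: \<iota>_def prod_eq_iff fun_eq_iff)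
  have \<iota>_bracket: "\<iota> i (lie_bracket (L i) a b) = ?br (\<iota> i a) (\<iota> i b)"
    if "i < r" "a \<in> lie_carrier (L i)" "b \<in> lie_carrier (L i)" for i a b
    using that L_0 L_br_0 by (auto simp: br \<iota>_def fun_eq_iff)
  have factor_subspace: "csubspace {a \<in> lie_carrier (L i). h (\<iota> i a) p = 0}" if "i < r" "p \<in> ?V" for i p
  proof -
    have "csubspace (lie_carrier (L i))"
      using complex_lie_algebra.subspace_carrier[OF L[OF that(1)]] .
    then show ?thesis
      using that \<iota>_in
      by (auto simp: complex_vector.subspace_def \<iota>_add \<iota>_scale \<iota>_zero zero_left add_left scale_left)
  qed
  have brackets_suffice: "h (\<iota> i a) p = 0"
    if i: "i < r" and p: "p \<in> ?V" and a: "a \<in> lie_carrier (L i)"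
      and "\<And>a b. \<lbrakk>a \<in> lie_carrier (L i); b \<in> lie_carrier (L i)\<rbrakk> \<Longrightarrow> h (?br (\<iota> i a) (\<iota> i b)) p = 0"
    for i p a
    using simple_spanned_by_brackets[OF simple[OF i] factor_subspace[OF i p]] that
      complex_lie_algebra.bracket_closed[OF L[OF i]]
    by (auto simp: \<iota>_bracket)
  have \<iota>_\<kappa>: "h (\<iota> i a) (\<kappa> x) = 0"
    if "i < r" "a \<in> lie_carrier (L i)" "x \<in> lie_carrier (euclidean_lie k)" for i a x
  proof (rule brackets_suffice[OF that(1) \<kappa>_in[OF that(3)] that(2)])
    have "?br (\<kappa> x) p = 0" if "p \<in> ?V" for p
      using that L_br_0 by (auto simp: br mem \<kappa>_def prod_eq_iff fun_eq_iff)
    then show "h (?br (\<iota> i a) (\<iota> i b)) (\<kappa> x) = 0"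
      if "a \<in> lie_carrier (L i)" "b \<in> lie_carrier (L i)" for a b
      using that \<kappa>_in \<iota>_in \<open>i < r\<close> \<open>x \<in> _\<close> by (intro centre_orthogonal_brackets) auto
  qed
  have factor_ideal: "lie_ideal ?P (\<iota> i ` lie_carrier (L i))" if i: "i < r" for i
    unfolding lie_ideal_def
  proof (intro conjI ballI)
    let ?N = "\<iota> i ` lie_carrier (L i)"
    have sub: "csubspace (lie_carrier (L i))"
      using complex_lie_algebra.subspace_carrier[OF L[OF i]] .
    show "csubspace ?N"
      unfolding complex_vector.subspace_def
    proof (intro conjI ballI allI)
      show "0 \<in> ?N" using L_0[OF i] \<iota>_zero by (metis image_eqI)
      show "p + q \<in> ?N" if "p \<in> ?N" "q \<in> ?N" for p q
        using that complex_vector.subspace_add[OF sub] by (auto simp: \<iota>_add[symmetric])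
      show "c *\<^sub>C p \<in> ?N" if "p \<in> ?N" for c p
        using that complex_vector.subspace_scale[OF sub] by (auto simp: \<iota>_scale[symmetric])
    qed
    show "?N \<subseteq> ?V" using \<iota>_in i by auto
    fix p q assume p: "p \<in> ?V" and "q \<in> ?N"
    then obtain a where a: "a \<in> lie_carrier (L i)" "q = \<iota> i a" by auto
    have "?br p q = \<iota> i (lie_bracket (L i) (snd p i) a)"
      using a p i L_br_0 by (auto simp: br \<iota>_def mem fun_eq_iff)
    moreover have "lie_bracket (L i) (snd p i) a \<in> lie_carrier (L i)"
      using a p i complex_lie_algebra.bracket_closed[OF L[OF i]] by (auto simp: mem)
    ultimately show "?br p q \<in> ?N" by blast
  qed
  have \<iota>_\<iota>: "h (\<iota> i a) (\<iota> j b) = 0"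
    if ij: "i < r" "j < r" "i \<noteq> j" and a: "a \<in> lie_carrier (L i)" and b: "b \<in> lie_carrier (L j)"
    for i j a b
  proof (rule brackets_suffice[OF ij(1) \<iota>_in[OF ij(2) b] a])
    fix a1 a2 assume a: "a1 \<in> lie_carrier (L i)" "a2 \<in> lie_carrier (L i)"
    have aV: "\<iota> i a1 \<in> ?V" "\<iota> i a2 \<in> ?V" using \<iota>_in ij a by auto
    have "h (\<iota> j b) (?br (\<iota> i a1) (\<iota> i a2)) = 0"
    proof (rule brackets_suffice[OF ij(2) _ b])
      fix b1 b2 assume b: "b1 \<in> lie_carrier (L j)" "b2 \<in> lie_carrier (L j)"
      show "h (?br (\<iota> j b1) (\<iota> j b2)) (?br (\<iota> i a1) (\<iota> i a2)) = 0"
      proof (rule commuting_ideals_orthogonal[OF factor_ideal[OF ij(1)]])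
        show "\<iota> j ` lie_carrier (L j) \<subseteq> ?V" using \<iota>_in ij by auto
        show "?br p q = 0" if "p \<in> \<iota> j ` lie_carrier (L j)" "q \<in> \<iota> i ` lie_carrier (L i)" for p q
          using that ij L_br_0 L_0 by (auto simp: br \<iota>_def prod_eq_iff fun_eq_iff)
      qed (use a b ij \<iota>_in in auto)
    qed (use aV in auto)
    then show "h (?br (\<iota> i a1) (\<iota> i a2)) (\<iota> j b) = 0"
      using hermitian[of "\<iota> j b" "?br (\<iota> i a1) (\<iota> i a2)"] aV \<iota>_in ij b by simp
  qed
  have decompose: "(x, u) = \<kappa> x + (\<Sum>i<r. \<iota> i (u i))" if "(x, u) \<in> ?V" for x u
  proof (rule prod_eqI)
    have fs: "fst (sum g A) = sum (\<lambda>x. fst (g x)) A" "snd (sum g A) = sum (\<lambda>x. snd (g x)) A"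
      for g :: "nat \<Rightarrow> (nat \<Rightarrow> complex) \<times> (nat \<Rightarrow> 'a)" and A
      by (induction A rule: infinite_finite_induct) auto
    have fa: "sum g A m = (\<Sum>x\<in>A. g x m)" for g :: "nat \<Rightarrow> nat \<Rightarrow> 'c::comm_monoid_add" and A m
      by (induction A rule: infinite_finite_induct) auto
    show "fst (x, u) = fst (\<kappa> x + (\<Sum>i<r. \<iota> i (u i)))"
      by (simp add: fs \<kappa>_def \<iota>_def)
    have "(\<Sum>i<r. if m = i then u i else 0) = u m" for m
      using that by (cases "m < r") (auto simp: mem)
    then show "snd (x, u) = snd (\<kappa> x + (\<Sum>i<r. \<iota> i (u i)))"
      by (simp add: fs fa \<kappa>_def \<iota>_def fun_eq_iff)
  qed
  have "h (x, u) (y, v) = h (\<kappa> x) (\<kappa> y) + (\<Sum>i<r. h (\<iota> i (u i)) (\<iota> i (v i)))"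
    if xu: "(x, u) \<in> ?V" and yv: "(y, v) \<in> ?V" for x u y v
  proof -
    have x: "x \<in> lie_carrier (euclidean_lie k)" "\<And>i. i < r \<Longrightarrow> u i \<in> lie_carrier (L i)"
      and y: "y \<in> lie_carrier (euclidean_lie k)" "\<And>i. i < r \<Longrightarrow> v i \<in> lie_carrier (L i)"
      using xu yv by (auto simp: mem euclidean_lie_def)
    have \<kappa>_\<iota>: "h (\<kappa> x) (\<iota> i (v i)) = 0" if "i < r" for i
      using hermitian[of "\<iota> i (v i)" "\<kappa> x"] \<iota>_\<kappa>[of i "v i" x] \<iota>_in \<kappa>_in that x y by simp
    have sums: "(\<Sum>i<r. \<iota> i (u i)) \<in> ?V" "(\<Sum>i<r. \<iota> i (v i)) \<in> ?V"
      using \<iota>_in x y by (auto intro!: complex_vector.subspace_sum[OF subspace])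
    have "h (\<iota> i (u i)) (\<Sum>j<r. \<iota> j (v j)) = h (\<iota> i (u i)) (\<iota> i (v i))" if "i < r" for i
    proof -
      have "h (\<iota> i (u i)) (\<Sum>j<r. \<iota> j (v j)) = (\<Sum>j<r. h (\<iota> i (u i)) (\<iota> j (v j)))"
        using that x y \<iota>_in by (intro sum_right) auto
      also have "\<dots> = (\<Sum>j\<in>{i}. h (\<iota> i (u i)) (\<iota> j (v j)))"
        using that x y \<iota>_\<iota> by (intro sum.mono_neutral_right) auto
      finally show ?thesis by simp
    qed
    moreover have "h (\<Sum>i<r. \<iota> i (u i)) (\<Sum>i<r. \<iota> i (v i))
        = (\<Sum>i<r. h (\<iota> i (u i)) (\<Sum>j<r. \<iota> j (v j)))"
      using sums x \<iota>_in by (intro sum_left) auto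
    ultimately have "h (\<Sum>i<r. \<iota> i (u i)) (\<Sum>i<r. \<iota> i (v i))
        = (\<Sum>i<r. h (\<iota> i (u i)) (\<iota> i (v i)))"
      by simp
    moreover have "h (\<Sum>i<r. \<iota> i (u i)) (\<kappa> y) = 0"
      using \<kappa>_in[OF y(1)] x y \<iota>_in by (subst sum_left) (auto simp: \<iota>_\<kappa>)
    moreover have "h (\<kappa> x) (\<Sum>i<r. \<iota> i (v i)) = 0"
      using \<kappa>_in[OF x(1)] x y \<iota>_in by (subst sum_right) (auto simp: \<kappa>_\<iota>)
    ultimately show ?thesis
      unfolding decompose[OF xu] decompose[OF yv]
      using sums \<kappa>_in[OF x(1)] \<kappa>_in[OF y(1)] by (simp add: add_left add_right)
  qed
  moreover have "hermitian_metric (euclidean_lie k) (\<lambda>x y. h (\<kappa> x) (\<kappa> y))"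
    using h \<kappa>_in
    by (rule hermitian_metric_pullback)
      (auto simp: \<kappa>_def prod_eq_iff scaleC_prod_def)
  moreover have "hermitian_metric (L i) (\<lambda>a b. h (\<iota> i a) (\<iota> i b))" if "i < r" for i
    using h \<iota>_in[OF that]
    by (rule hermitian_metric_pullback)
      (auto simp: \<iota>_add \<iota>_scale, auto simp: \<iota>_def prod_eq_iff fun_eq_iff split: if_splits)
  ultimately show ?thesis
    by (intro exI[of _ "\<lambda>x y. h (\<kappa> x) (\<kappa> y)"] exI[of _ "\<lambda>i a b. h (\<iota> i a) (\<iota> i b)"]) auto
qed

theorem theorem3p4:
  fixes k r :: nat and L :: "nat \<Rightarrow> 'a::complex_vector lie"
  assumes simple: "\<And>i. i < r \<Longrightarrow> simple_complex_lie_algebra (L i)"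
  shows
    "(\<forall>h. hermitian_metric (product_lie k r L) h \<and> BTP (product_lie k r L) h \<longrightarrow>
        (\<exists>h0 hs. hermitian_metric (euclidean_lie k) h0 \<and>
           (\<forall>i<r. hermitian_metric (L i) (hs i)) \<and>
           (\<forall>(x, u)\<in>lie_carrier (product_lie k r L). \<forall>(y, v)\<in>lie_carrier (product_lie k r L).
              h (x, u) (y, v) = h0 x y + (\<Sum>i<r. hs i (u i) (v i))) \<and>
           kaehler (euclidean_lie k) h0 \<and> flat (euclidean_lie k) h0)) \<and>
     (\<forall>i<r. \<forall>g h. hermitian_metric (L i) g \<and> BTP (L i) g \<and>
        hermitian_metric (L i) h \<and> BTP (L i) h \<longrightarrow>
        (\<exists>(c::real) f. B_isometry (L i) f \<and>
           (\<forall>x\<in>lie_carrier (L i). \<forall>y\<in>lie_carrier (L i). h x y = complex_of_real c * g (f x) y)))"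
proof (intro conjI allI impI)
  fix h assume h: "hermitian_metric (product_lie k r L) h \<and> BTP (product_lie k r L) h"
  show "\<exists>h0 hs. hermitian_metric (euclidean_lie k) h0 \<and>
      (\<forall>i<r. hermitian_metric (L i) (hs i)) \<and>
      (\<forall>(x, u)\<in>lie_carrier (product_lie k r L). \<forall>(y, v)\<in>lie_carrier (product_lie k r L).
         h (x, u) (y, v) = h0 x y + (\<Sum>i<r. hs i (u i) (v i))) \<and>
      kaehler (euclidean_lie k) h0 \<and> flat (euclidean_lie k) h0"
    using BTP_metric_on_product[where L = L, OF simple] h euclidean_metric_kaehler_flat by blast
next
  fix i g h
  assume i: "i < r"
    and gh: "hermitian_metric (L i) g \<and> BTP (L i) g \<and> hermitian_metric (L i) h \<and> BTP (L i) h"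
  obtain \<sigma> where "simple_lie_algebra_involution (L i) g \<sigma>"
    using BTP_simple_involution[OF simple[OF i]] gh by blast
  moreover obtain \<tau> where "simple_lie_algebra_involution (L i) h \<tau>"
    using BTP_simple_involution[OF simple[OF i]] gh by blast
  ultimately show "\<exists>(c::real) f. B_isometry (L i) f \<and>
      (\<forall>x\<in>lie_carrier (L i). \<forall>y\<in>lie_carrier (L i). h x y = complex_of_real c * g (f x) y)"
    by (rule simple_metrics_proportional_up_to_automorphism)
qed

end
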